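(* Consider an $[[n,1,d]]$ stabilizer code with logical basis states $|0_L\rangle,|1_L\rangle$, let $0\le\lambda\le 1/2$, and consider the state $|\psi_{\mathrm{enc}}\rangle=\sqrt{\lambda}\,|0\rangle_T|0_L\rangle+\sqrt{1-\lambda}\,|1\rangle_T|1_L\rangle$. Let $A,B\subseteq\{1,\dots,n\}$ be disjoint subsets of the physical qubits. Then $A$ and $B$ possess synergistic capacity with respect to one another, i.e. $C_{\mathrm{syn}}\neq 0$ for the C-PID of the reduced state $\rho_{TAB}$ of $|\psi_{\mathrm{enc}}\rangle$, if and only if there is a logical operator that is supported on $A\cup B$ but is supported neither on $A$ nor on $B$ individually.
   Context: Stabilizer codes: $S$ is an abelian subgroup of the $n$-qubit Pauli group with $-\mathbb{1}\notin S$ and $n-1$ independent generators; the codespace is the simultaneous $+1$ eigenspace of $S$ (dimension 2), and $d$ is the code distance. Anticommuting Hermitian Pauli operators $\bar Z,\bar X$ commuting with all of $S$ but not in $S$ are fixed, and $|0_L\rangle,|1_L\rangle$ are the $+1$ and $-1$ eigenvectors of $\bar Z$ in the codespace. A logical operator is one of the three nontrivial cosets $\bar X S,\bar Y S,\bar Z S$ (with $\bar Y=i\bar X\bar Z$, phases ignored); it is supported on a subset $R$ of the qubits if the coset contains a representative acting as the identity (up to phase) on every qubit outside $R$. C-PID of $\rho_{TAB}$ ($T$ a qubit): $H(\cdot)$ is the von Neumann entropy with base-2 logarithm. Let $\sigma_x,\sigma_y,\sigma_z$ be the Pauli matrices on $T$ with respect to the eigenbasis $\{|0\rangle,|1\rangle\}$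 of $\rho_T$; $\sigma_x^{\phi}=\cos\phi\,\sigma_x+\sin\phi\,\sigma_y$. For $R\in\{A,B,AB\}$ (where $AB$ denotes $A\cup B$): $C_R=1+H(\rho_R)-H(\rho_{TR})$. For a Hermitian unitary $\sigma$ on $T$, $\Phi_\sigma(\rho_{TR})=\frac12\left(\rho_{TR}+(\sigma\otimes\mathbb{1})\rho_{TR}(\sigma\otimes\mathbb{1})\right)$; for $R\in\{A,B\}$, $\mathcal{C}_R^{\parallel}=H(\Phi_{\sigma_z}(\rho_{TR}))-H(\rho_{TR})$ and $\mathcal{C}_R^{\perp}=\frac1{2\pi}\int_0^{2\pi}[H(\Phi_{\sigma_x^{\phi}}(\rho_{TR}))-H(\rho_{TR})]\,d\phi$. $\Gamma_A=\max(\mathcal{C}_A^{\parallel}-\mathcal{C}_B^{\parallel},0)+\max(\mathcal{C}_A^{\perp}-\mathcal{C}_B^{\perp},0)$, $\Gamma_B$ the same with $A,B$ exchanged; $\Delta_A=(C_A-C_B)-(\Gamma_A-\Gamma_B)$, $\Delta_B=-\Delta_A$; $\gamma_A=\Gamma_A+\min(\Delta_A,0)$, $\gamma_B=\Gamma_B+\min(\Delta_B,0)$. The synergistic capacity is $C_{\mathrm{syn}}=C_{AB}-\frac12(C_A+C_B+|\gamma_A|+|\gamma_B|)$.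
   Formalization: The formal theorem takes 0 < λ ≤ 1/2; at λ = 0 the claim is false, since the state is a product and C_syn = 0 for all A, B, although a logical operator can be supported on A∪B only (e.g. S = {1, ZZ}, X̄ = XX, A = {1}, B = {2}). *)

theory Defs
  imports "HOL-Analysis.Analysis" "HOL-Algebra.Coset" "HOL-Algebra.Generated_Groups"
begin

text \<open>
  Qubits are labelled by a finite type \<open>'q\<close>. A computational basis state is the set of those
  qubits that are in state 1, so the Hilbert space of all qubits is \<open>complex ^ 'q set\<close>.
  A single qubit has index type \<^typ>\<open>bool\<close>, with \<^term>\<open>False\<close> for 0 and \<^term>\<open>True\<close> for 1.
\<close>

type_synonym 'i cvec = "complex ^ 'i"
type_synonym 'i cmat = "complex ^ 'i ^ 'i"

definition ket :: "'i::finite \<Rightarrow> 'i cvec" where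
  "ket i = axis i 1"

definition outer :: "'i::finite cvec \<Rightarrow> 'i cvec \<Rightarrow> 'i cmat" where
  "outer u v = (\<chi> i j. u $ i * cnj (v $ j))"

definition hermitian :: "'i::finite cmat \<Rightarrow> bool" where
  "hermitian M \<longleftrightarrow> (\<chi> i j. cnj (M $ j $ i)) = M"

subsection \<open>Pauli matrices\<close>

text \<open>Pauli matrices of one qubit with respect to an orthonormal basis \<open>e0\<close>, \<open>e1\<close>.\<close>

definition sigma_x :: "bool cvec \<Rightarrow> bool cvec \<Rightarrow> bool cmat" where
  "sigma_x e0 e1 = outer e0 e1 + outer e1 e0"

definition sigma_y :: "bool cvec \<Rightarrow> bool cvec \<Rightarrow> bool cmat" where
  "sigma_y e0 e1 = outer (\<i> *s e1) e0 - outer (\<i> *s e0) e1"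

definition sigma_z :: "bool cvec \<Rightarrow> bool cvec \<Rightarrow> bool cmat" where
  "sigma_z e0 e1 = outer e0 e0 - outer e1 e1"

definition sigma_phi :: "bool cvec \<Rightarrow> bool cvec \<Rightarrow> real \<Rightarrow> bool cmat" where
  "sigma_phi e0 e1 \<phi> = cos \<phi> *\<^sub>R sigma_x e0 e1 + sin \<phi> *\<^sub>R sigma_y e0 e1"

datatype pauli = PI | PX | PY | PZ

primrec pauli_mat :: "pauli \<Rightarrow> bool cmat" where
  "pauli_mat PI = mat 1"
| "pauli_mat PX = sigma_x (ket False) (ket True)"
| "pauli_mat PY = sigma_y (ket False) (ket True)"
| "pauli_mat PZ = sigma_z (ket False) (ket True)"

text \<open>The tensor product over all qubits \<open>q\<close> of \<open>pauli_mat (f q)\<close>, multiplied by \<open>c\<close>.\<close>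

definition pauli_op :: "complex \<Rightarrow> ('q::finite \<Rightarrow> pauli) \<Rightarrow> 'q set cmat" where
  "pauli_op c f = (\<chi> x y. c * (\<Prod>q\<in>UNIV. pauli_mat (f q) $ (q \<in> x) $ (q \<in> y)))"

definition phases :: "complex set" where
  "phases = {1, -1, \<i>, -\<i>}"

definition pauli_group :: "'q::finite set cmat monoid" where
  "pauli_group = \<lparr>carrier = {pauli_op c f | c f. c \<in> phases}, mult = (**), one = mat 1\<rparr>"

subsection \<open>Stabilizer codes\<close>

definition commutes_with :: "'i::finite cmat \<Rightarrow> 'i cmat set \<Rightarrow> bool" where
  "commutes_with P S \<longleftrightarrow> (\<forall>s\<in>S. P ** s = s ** P)"

definition independent_gens :: "'q::finite set cmat set \<Rightarrow> bool" where
  "independent_gens G \<longleftrightarrow> (\<forall>g\<in>G. g \<notin> generate pauli_group (G - {g}))"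

definition code_distance :: "'q::finite set cmat set \<Rightarrow> nat" where
  "code_distance S = (LEAST w. \<exists>f. commutes_with (pauli_op 1 f) S
      \<and> (\<forall>c\<in>phases. pauli_op c f \<notin> S) \<and> card {q. f q \<noteq> PI} = w)"

text \<open>\<open>S\<close> is the stabilizer group of an $[[n,1,d]]$ code, where $n$ is \<open>CARD('q)\<close>.\<close>

definition stabilizer_code :: "'q::finite set cmat set \<Rightarrow> nat \<Rightarrow> bool" where
  "stabilizer_code S d \<longleftrightarrow>
     subgroup S pauli_group \<and> (\<forall>s\<in>S. commutes_with s S) \<and> - mat 1 \<notin> S \<and>
     (\<exists>G \<subseteq> carrier pauli_group. card G = CARD('q) - 1 \<and> independent_gens G \<and>
        generate pauli_group G = S) \<and>
     code_distance S = d"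

definition codespace :: "'q::finite set cmat set \<Rightarrow> 'q set cvec set" where
  "codespace S = {v. \<forall>s\<in>S. s *v v = v}"

definition logical_paulis :: "'q::finite set cmat set \<Rightarrow> 'q set cmat \<Rightarrow> 'q set cmat \<Rightarrow> bool" where
  "logical_paulis S Xb Zb \<longleftrightarrow>
     (\<forall>P\<in>{Xb, Zb}. P \<in> carrier pauli_group \<and> hermitian P \<and> commutes_with P S \<and> P \<notin> S) \<and>
     Zb ** Xb = - (Xb ** Zb)"

definition logical_basis ::
  "'q::finite set cmat set \<Rightarrow> 'q set cmat \<Rightarrow> 'q set cvec \<Rightarrow> 'q set cvec \<Rightarrow> bool" where
  "logical_basis S Zb l0 l1 \<longleftrightarrow>
     l0 \<in> codespace S \<and> norm l0 = 1 \<and> Zb *v l0 = l0 \<and>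
     l1 \<in> codespace S \<and> norm l1 = 1 \<and> Zb *v l1 = - l1"

definition logical_ops ::
  "'q::finite set cmat set \<Rightarrow> 'q set cmat \<Rightarrow> 'q set cmat \<Rightarrow> 'q set cmat set set" where
  "logical_ops S Xb Zb = {Xb <#\<^bsub>pauli_group\<^esub> S, (mat \<i> ** Xb ** Zb) <#\<^bsub>pauli_group\<^esub> S, Zb <#\<^bsub>pauli_group\<^esub> S}"

definition supported_on :: "'q::finite set cmat set \<Rightarrow> 'q set \<Rightarrow> bool" where
  "supported_on L R \<longleftrightarrow>
     (\<exists>P\<in>L. \<exists>c\<in>phases. \<exists>f. P = pauli_op c f \<and> (\<forall>q. q \<notin> R \<longrightarrow> f q = PI))"

subsection \<open>Reduced states and entropy\<close>

text \<open>
  The reduced state on the qubits in \<open>R\<close>. Its entries are indexed by subsets of \<open>R\<close>; to stay in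
  the same matrix type it is padded with zero rows and columns, which changes no entropy.
\<close>

definition ptrace :: "'q::finite set \<Rightarrow> 'q set cmat \<Rightarrow> 'q set cmat" where
  "ptrace R \<rho> = (\<chi> x y. if x \<subseteq> R \<and> y \<subseteq> R
      then (\<Sum>z\<in>Pow (- R). \<rho> $ (x \<union> z) $ (y \<union> z)) else 0)"

definition eigenspace :: "'i::finite cmat \<Rightarrow> real \<Rightarrow> 'i cvec set" where
  "eigenspace \<rho> p = {v. \<rho> *v v = complex_of_real p *s v}"

text \<open>
  Von Neumann entropy in bits: \<open>- (\<Sum> p * log 2 p)\<close> over the eigenvalues of the Hermitian matrix
  \<open>\<rho>\<close>, counted with multiplicity. The eigenvalue 0 contributes 0.
\<close>

definition vn_entropy :: "'i::finite cmat \<Rightarrow> real" where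
  "vn_entropy \<rho> = - (\<Sum>p | eigenspace \<rho> p \<noteq> {0}. real (vec.dim (eigenspace \<rho> p)) * (p * log 2 p))"

subsection \<open>The C-PID\<close>

text \<open>
  In this section \<open>\<rho>\<close> is a state of all qubits, \<open>T\<close> is one qubit, \<open>R\<close>, \<open>A\<close>, \<open>B\<close> are sets of
  qubits without \<open>T\<close>, and \<open>e0\<close>, \<open>e1\<close> is an orthonormal eigenbasis of \<open>\<rho>\<^sub>T\<close>.
\<close>

definition on_qubit :: "'q::finite \<Rightarrow> bool cmat \<Rightarrow> 'q set cmat" where
  "on_qubit T u = (\<chi> x y. if x - {T} = y - {T} then u $ (T \<in> x) $ (T \<in> y) else 0)"

definition twirl :: "'q::finite \<Rightarrow> bool cmat \<Rightarrow> 'q set cmat \<Rightarrow> 'q set cmat" where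
  "twirl T \<sigma> \<rho> = (1/2) *\<^sub>R (\<rho> + on_qubit T \<sigma> ** \<rho> ** on_qubit T \<sigma>)"

definition cap :: "'q::finite set cmat \<Rightarrow> 'q \<Rightarrow> 'q set \<Rightarrow> real" where
  "cap \<rho> T R = 1 + vn_entropy (ptrace R \<rho>) - vn_entropy (ptrace (insert T R) \<rho>)"

definition cap_sigma :: "'q::finite set cmat \<Rightarrow> 'q \<Rightarrow> bool cmat \<Rightarrow> 'q set \<Rightarrow> real" where
  "cap_sigma \<rho> T \<sigma> R =
     vn_entropy (twirl T \<sigma> (ptrace (insert T R) \<rho>)) - vn_entropy (ptrace (insert T R) \<rho>)"

definition cap_par ::
  "'q::finite set cmat \<Rightarrow> 'q \<Rightarrow> bool cvec \<Rightarrow> bool cvec \<Rightarrow> 'q set \<Rightarrow> real" where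
  "cap_par \<rho> T e0 e1 R = cap_sigma \<rho> T (sigma_z e0 e1) R"

definition cap_perp ::
  "'q::finite set cmat \<Rightarrow> 'q \<Rightarrow> bool cvec \<Rightarrow> bool cvec \<Rightarrow> 'q set \<Rightarrow> real" where
  "cap_perp \<rho> T e0 e1 R =
     1 / (2 * pi) * integral {0..2 * pi} (\<lambda>\<phi>. cap_sigma \<rho> T (sigma_phi e0 e1 \<phi>) R)"

text \<open>\<open>big_gamma \<dots> A B\<close> is \<open>\<Gamma>\<^sub>A\<close> and \<open>big_gamma \<dots> B A\<close> is \<open>\<Gamma>\<^sub>B\<close>; likewise for
  \<open>big_delta\<close> (\<open>\<Delta>\<close>) and \<open>small_gamma\<close> (\<open>\<gamma>\<close>).\<close>

definition big_gamma ::
  "'q::finite set cmat \<Rightarrow> 'q \<Rightarrow> bool cvec \<Rightarrow> bool cvec \<Rightarrow> 'q set \<Rightarrow> 'q set \<Rightarrow> real" where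
  "big_gamma \<rho> T e0 e1 A B =
     max (cap_par \<rho> T e0 e1 A - cap_par \<rho> T e0 e1 B) 0 +
     max (cap_perp \<rho> T e0 e1 A - cap_perp \<rho> T e0 e1 B) 0"

definition big_delta ::
  "'q::finite set cmat \<Rightarrow> 'q \<Rightarrow> bool cvec \<Rightarrow> bool cvec \<Rightarrow> 'q set \<Rightarrow> 'q set \<Rightarrow> real" where
  "big_delta \<rho> T e0 e1 A B =
     (cap \<rho> T A - cap \<rho> T B) - (big_gamma \<rho> T e0 e1 A B - big_gamma \<rho> T e0 e1 B A)"

definition small_gamma ::
  "'q::finite set cmat \<Rightarrow> 'q \<Rightarrow> bool cvec \<Rightarrow> bool cvec \<Rightarrow> 'q set \<Rightarrow> 'q set \<Rightarrow> real" where
  "small_gamma \<rho> T e0 e1 A B = big_gamma \<rho> T e0 e1 A B + min (big_delta \<rho> T e0 e1 A B) 0"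

definition syn_cap ::
  "'q::finite set cmat \<Rightarrow> 'q \<Rightarrow> bool cvec \<Rightarrow> bool cvec \<Rightarrow> 'q set \<Rightarrow> 'q set \<Rightarrow> real" where
  "syn_cap \<rho> T e0 e1 A B = cap \<rho> T (A \<union> B) - 1/2 * (cap \<rho> T A + cap \<rho> T B
     + \<bar>small_gamma \<rho> T e0 e1 A B\<bar> + \<bar>small_gamma \<rho> T e0 e1 B A\<bar>)"

subsection \<open>The encoded state\<close>

text \<open>
  The system consisting of \<open>T\<close> and the physical qubits \<open>'n\<close> has label type \<open>'n option\<close>:
  \<^term>\<open>None\<close> is \<open>T\<close> and \<^term>\<open>Some q\<close> is the physical qubit \<open>q\<close>.
\<close>

definition tensor_T :: "bool cvec \<Rightarrow> 'n::finite set cvec \<Rightarrow> 'n option set cvec" where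
  "tensor_T t v = (\<chi> x. t $ (None \<in> x) * v $ (Some -` x))"

text \<open>
  For \<open>lam = 0\<close> this is a product state between \<open>T\<close> and the code, so the synergistic capacity of
  all \<open>A\<close>, \<open>B\<close> is 0, whatever logical operators \<open>A \<union> B\<close> supports. Characterizing non-zero
  synergistic capacity by logical operators therefore needs \<open>0 < lam\<close>.
\<close>

definition psi_enc :: "real \<Rightarrow> 'n::finite set cvec \<Rightarrow> 'n set cvec \<Rightarrow> 'n option set cvec" where
  "psi_enc lam l0 l1 = complex_of_real (sqrt lam) *s tensor_T (ket False) l0
     + complex_of_real (sqrt (1 - lam)) *s tensor_T (ket True) l1"

definition rho_TAB ::
  "real \<Rightarrow> 'n::finite set cvec \<Rightarrow> 'n set cvec \<Rightarrow> 'n set \<Rightarrow> 'n set \<Rightarrow> 'n option set cmat" where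
  "rho_TAB lam l0 l1 A B =
     ptrace (insert None (Some ` (A \<union> B))) (outer (psi_enc lam l0 l1) (psi_enc lam l0 l1))"

text \<open>
  The reduced state of \<open>T\<close> is diagonal in \<open>ket False\<close>, \<open>ket True\<close> with eigenvalues \<open>lam\<close> and
  \<open>1 - lam\<close>, so this basis is the one used for the C-PID (also when \<open>lam = 1/2\<close>, where the
  eigenbasis is not unique).
\<close>

definition encoded_syn_cap ::
  "real \<Rightarrow> 'n::finite set cvec \<Rightarrow> 'n set cvec \<Rightarrow> 'n set \<Rightarrow> 'n set \<Rightarrow> real" where
  "encoded_syn_cap lam l0 l1 A B =
     syn_cap (rho_TAB lam l0 l1 A B) None (ket False) (ket True) (Some ` A) (Some ` B)"

end

(*
  Write the encoded state as a 2x2 block matrix over T with blocks |i_L><j_L|, where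
  |0_L><0_L| = m(1 + Z) and |1_L><1_L| = m(1 - Z) for m half of the code projector, and |0_L><1_L|
  is |0_L><0_L| X up to a phase. After tracing out the qubits outside R, the operator m L survives
  exactly when the logical operator L has a representative supported on R, and f, the partial trace
  of m, is a multiple of a projector. So up to a common shift all entropies of a region R depend
  only on which logical operators R supports. With h the binary entropy of lam, the triple
  (C, parallel part, perpendicular part) is (1 - h, 0, 1 - h) if R supports none, (1, 0, 1) for Z
  alone, (1, h, g) for X or Y alone, where g does not depend on R, and (1 + h, h, 1) for all three.
  Two disjoint regions cannot support anticommuting logical operators; in each of the remaining
  cases C_syn is C_AB minus the larger of C_A and C_B, whatever g is.
*)
theory Submission
  imports Defs
begin

text \<open>Entropy is defined through dimensions of eigenspaces, so nothing is diagonalized: each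
  state is written as a combination of at most two mutually annihilating matrices P with P^2 = k P,
  and the dimension of the eigenspace is the trace of the idempotent P / k. The level k depends on
  how many stabilizers live on the region, but it enters each entropy of that region as the same
  term -log k and cancels in the differences that make up the C-PID. The logical basis vectors are
  fixed only up to phases, so the relation between |0_L><1_L| and |0_L><0_L| X contains an unknown
  unit \<mu>, which shifts the twirl angle \<phi>. X alone and Y alone therefore get two separate
  perpendicular averages; these stay unevaluated and never have to be compared with each
  other.\<close>

section \<open>Complex multiples and adjoints of matrices\<close>

definition cscale :: "complex \<Rightarrow> 'i::finite cmat \<Rightarrow> 'i cmat" (infixr "\<odot>" 75) where
  "c \<odot> M = (\<chi> i j. c * M $ i $ j)"

definition adj :: "'i::finite cmat \<Rightarrow> 'i cmat" where
  "adj M = (\<chi> i j. cnj (M $ j $ i))"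

lemma cscale_nth [simp]: "(c \<odot> M) $ i $ j = c * M $ i $ j"
  by (simp add: cscale_def)

lemma mat_eq_iff: "M = N \<longleftrightarrow> (\<forall>i j. M $ i $ j = N $ i $ j)"
  by (simp add: vec_eq_iff)

lemma matrix_mult_nth: "(A ** B) $ i $ j = (\<Sum>k\<in>UNIV. A $ i $ k * B $ k $ j)"
  by (simp add: matrix_matrix_mult_def)

lemma scaleR_eq_cscale: "r *\<^sub>R M = complex_of_real r \<odot> M"
  by (simp add: mat_eq_iff) (simp add: scaleR_conv_of_real)

lemma cscale_mult_left [simp]: "(c \<odot> M) ** N = c \<odot> (M ** N)"
  by (simp add: mat_eq_iff matrix_mult_nth sum_distrib_left mult.assoc)

lemma cscale_mult_right [simp]: "M ** (c \<odot> N) = c \<odot> (M ** N)"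
  by (simp add: mat_eq_iff matrix_mult_nth sum_distrib_left mult.left_commute)

lemma cscale_cscale [simp]: "c \<odot> d \<odot> M = (c * d) \<odot> M"
  by (simp add: mat_eq_iff)

lemma cscale_add: "c \<odot> (M + N) = c \<odot> M + c \<odot> N"
  by (simp add: mat_eq_iff algebra_simps)

lemma cscale_diff: "c \<odot> (M - N) = c \<odot> M - c \<odot> N"
  by (simp add: mat_eq_iff algebra_simps)

lemma cscale_0_right [simp]: "c \<odot> 0 = 0"
  by (simp add: mat_eq_iff)

lemma cscale_0_left [simp]: "0 \<odot> M = 0"
  by (simp add: mat_eq_iff)

lemma cscale_1 [simp]: "1 \<odot> M = M"
  by (simp add: mat_eq_iff)

lemma cscale_minus1: "- 1 \<odot> M = - M"
  by (simp add: mat_eq_iff)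

lemma mult_minus_left_mat [simp]: "(- M) ** (N :: 'i::finite cmat) = - (M ** N)"
  by (simp add: mat_eq_iff matrix_mult_nth sum_negf)

lemma mult_minus_right_mat [simp]: "M ** (- N :: 'i::finite cmat) = - (M ** N)"
  by (simp add: mat_eq_iff matrix_mult_nth sum_negf)

lemma mult_diff_left_mat: "(M - M') ** (N :: 'i::finite cmat) = M ** N - M' ** N"
  by (simp add: mat_eq_iff matrix_mult_nth sum_subtractf left_diff_distrib)

lemma mult_diff_right_mat: "(N :: 'i::finite cmat) ** (M - M') = N ** M - N ** M'"
  by (simp add: mat_eq_iff matrix_mult_nth sum_subtractf right_diff_distrib)

lemma mult_add_left_mat: "(M + M') ** (N :: 'i::finite cmat) = M ** N + M' ** N"
  by (simp add: mat_eq_iff matrix_mult_nth sum.distrib distrib_right)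

lemma mult_sum_left_mat: "(\<Sum>a\<in>I. F a) ** (N :: 'i::finite cmat) = (\<Sum>a\<in>I. F a ** N)"
  by (induction I rule: infinite_finite_induct) (simp_all add: mult_add_left_mat)

lemma mult_sum_right_mat: "(N :: 'i::finite cmat) ** (\<Sum>a\<in>I. F a) = (\<Sum>a\<in>I. N ** F a)"
  by (induction I rule: infinite_finite_induct) (simp_all add: matrix_add_ldistrib)

lemma mat_eq_cscale: "(mat c :: 'i::finite cmat) = c \<odot> mat 1"
  by (simp add: mat_eq_iff mat_def)

lemmas mat_distribs = matrix_add_ldistrib mult_add_left_mat mult_diff_left_mat
  mult_diff_right_mat cscale_add cscale_diff matrix_mul_assoc

lemma trace_cscale [simp]: "trace (c \<odot> M) = c * trace M"
  by (simp add: trace_def sum_distrib_left)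

lemma cscale_vec: "(c \<odot> M) *v v = c *s (M *v v)"
  by (simp add: vec_eq_iff matrix_vector_mult_def sum_distrib_left mult.assoc)

lemma adj_nth [simp]: "adj M $ i $ j = cnj (M $ j $ i)"
  by (simp add: adj_def)

lemma hermitian_iff_adj: "hermitian M \<longleftrightarrow> adj M = M"
  by (simp add: hermitian_def adj_def)

lemma adj_mult: "adj (M ** N) = adj N ** adj M"
  by (simp add: mat_eq_iff matrix_mult_nth mult.commute)

lemma adj_add: "adj (M + N) = adj M + adj N"
  by (simp add: mat_eq_iff)

lemma adj_cscale: "adj (c \<odot> M) = cnj c \<odot> adj M"
  by (simp add: mat_eq_iff)

lemma adj_sum: "adj (\<Sum>a\<in>I. F a) = (\<Sum>a\<in>I. adj (F a))"
  by (simp add: mat_eq_iff)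

lemma outer_nth [simp]: "outer u v $ i $ j = u $ i * cnj (v $ j)"
  by (simp add: outer_def)

lemma outer_mult_right: "outer u v ** M = outer u (adj M *v v)"
  by (simp add: mat_eq_iff matrix_mult_nth matrix_vector_mult_def sum_distrib_left mult_ac)

lemma outer_mult_left: "M ** outer u v = outer (M *v u) v"
  by (simp add: mat_eq_iff matrix_mult_nth matrix_vector_mult_def sum_distrib_right mult.assoc)

lemma norm_vec_square: "(\<Sum>i\<in>UNIV. u $ i * cnj (u $ i)) = complex_of_real ((norm u)\<^sup>2)"
  for u :: "'i::finite cvec"
  by (simp add: norm_vec_def L2_set_def sum_nonneg complex_norm_square[symmetric])

subsection \<open>Entropy of matrices with at most two nonzero eigenvalues\<close>

text \<open>Every \<open>P *v x\<close> lies in the fixed space and can be expanded in a basis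
  \<open>B\<close> of it. The diagonal sum of \<open>P\<close> then becomes the sum over
  \<open>b\<close> in \<open>B\<close> of the \<open>b\<close>-coordinate of
  \<open>P *v b = b\<close>, which is 1.\<close>

lemma trace_idempotent:
  fixes P :: "'i::finite cmat"
  assumes "P ** P = P"
  shows "of_nat (vec.dim {v. P *v v = v}) = trace P"
proof -
  let ?V = "{v. P *v v = v}"
  have sub: "vec.subspace ?V"
    by (rule vec.subspaceI) (auto simp: matrix_vector_right_distrib vector_scalar_commute)
  obtain B where B: "B \<subseteq> ?V" "vec.independent B" "?V \<subseteq> vec.span B" "card B = vec.dim ?V"
    by (rule vec.basis_exists[of ?V])
  have span: "vec.span B = ?V"
    using B sub by (simp add: vec.span_minimal subset_antisym)
  have fin: "finite B"
    using B(2) by (rule vec.finiteI_independent)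
  have PB: "P *v x \<in> vec.span B" for x
    using assms by (simp add: span matrix_vector_mul_assoc)
  \<comment> \<open>\<open>r x b\<close> is the \<open>b\<close>-coordinate of
    \<open>P *v x\<close>, a linear functional of \<open>x\<close>.\<close>
  define r where "r x = vec.representation B (P *v x)" for x
  have r_add: "r (x + y) b = r x b + r y b" for x y b
    unfolding r_def by (simp add: matrix_vector_right_distrib vec.representation_add B(2) PB)
  have r_scale: "r (c *s x) b = c * r x b" for c x b
    unfolding r_def by (simp add: vector_scalar_commute vec.representation_scale B(2) PB)
  have r_0: "r 0 b = 0" for b
    using r_scale[of 0 0 b] by simp
  have r_sum: "r (\<Sum>i\<in>I. F i) b = (\<Sum>i\<in>I. r (F i) b)" for F :: "'i \<Rightarrow> _" and I b
    by (induction I rule: infinite_finite_induct) (simp_all add: r_add r_0)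
  have "trace P = (\<Sum>i\<in>UNIV. (P *v axis i 1) $ i)"
    by (simp add: trace_def matrix_vector_mult_def axis_def if_distrib cong: if_cong)
  also have "\<dots> = (\<Sum>i\<in>UNIV. (\<Sum>b\<in>B. r (axis i 1) b *s b) $ i)"
    using vec.sum_representation_eq[OF B(2) PB fin] by (simp add: r_def)
  \<comment> \<open>The entry \<open>b $ i\<close> moves into the linear argument, so that the inner
    sum reassembles \<open>b\<close> from unit vectors.\<close>
  also have "\<dots> = (\<Sum>b\<in>B. \<Sum>i\<in>UNIV. r (b $ i *s axis i 1) b)"
    by (simp add: r_scale mult.commute) (rule sum.swap)
  also have "\<dots> = (\<Sum>b\<in>B. r b b)"
    by (simp add: r_sum[symmetric] basis_expansion)
  also have "\<dots> = (\<Sum>b\<in>B. 1)"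
  proof (rule sum.cong)
    fix b assume b: "b \<in> B"
    then have "P *v b = b" using B(1) by blast
    then show "r b b = 1"
      using b by (simp add: r_def vec.representation_basis[OF B(2)])
  qed simp
  finally show ?thesis
    using B(4) by simp
qed

text \<open>Dividing by \<open>k\<close> gives an idempotent whose fixed vectors are the
  eigenvectors of \<open>P\<close> for \<open>k\<close>; multiplicities are thus read off from
  traces.\<close>

lemma dim_eigenspace:
  fixes P :: "'i::finite cmat"
  assumes P: "P ** P = complex_of_real k \<odot> P" and k: "k \<noteq> 0"
  shows "of_nat (vec.dim (eigenspace P k)) = trace P / k"
proof -
  have "(complex_of_real (1 / k) \<odot> P) ** (complex_of_real (1 / k) \<odot> P) = complex_of_real (1 / k) \<odot> P"
    using k by (simp add: P)
  from trace_idempotent[OF this]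
  have "of_nat (vec.dim {v. (complex_of_real (1 / k) \<odot> P) *v v = v}) = trace P / k"
    by simp
  moreover have "{v. (complex_of_real (1 / k) \<odot> P) *v v = v} = eigenspace P k"
    using k by (auto simp: eigenspace_def cscale_vec vec_eq_iff field_simps)
  ultimately show ?thesis by simp
qed

text \<open>Non-eigenvalues in \<open>F\<close> are harmless because \<open>{0}\<close> has
  dimension 0, and the eigenvalue 0 because its term is a multiple of 0. It therefore suffices to
  bound the spectrum from above by a finite set.\<close>

lemma vn_entropy_eq_sum:
  assumes F: "finite F" and sub: "\<And>p. p \<noteq> 0 \<Longrightarrow> p \<notin> F \<Longrightarrow> eigenspace M p = {0}"
  shows "vn_entropy M = - (\<Sum>p\<in>F. real (vec.dim (eigenspace M p)) * (p * log 2 p))"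
proof -
  let ?t = "\<lambda>p. real (vec.dim (eigenspace M p)) * (p * log 2 p)"
  let ?E = "{p. eigenspace M p \<noteq> {0}}"
  have E: "?E \<subseteq> insert 0 F" using sub by blast
  have "(\<Sum>p\<in>?E. ?t p) = (\<Sum>p\<in>insert 0 F. ?t p)"
    by (rule sum.mono_neutral_left) (use F E in \<open>auto\<close>)
  also have "\<dots> = (\<Sum>p\<in>F. ?t p)"
    by (rule sum.mono_neutral_right) (use F in auto)
  finally show ?thesis by (simp add: vn_entropy_def)
qed

text \<open>\<open>P\<close> and \<open>Q\<close> are \<open>k\<close> times idempotents that
  annihilate each other, so the only possible nonzero eigenvalues are \<open>a * k\<close> and
  \<open>b * k\<close>, with multiplicities \<open>s / k\<close> and \<open>t / k\<close>. The
  formula also covers the cases where the two values coincide or one of them is 0.\<close>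

lemma vn_entropy_two:
  fixes P Q :: "'i::finite cmat"
  assumes P: "P ** P = complex_of_real k \<odot> P" and Q: "Q ** Q = complex_of_real k \<odot> Q"
    and PQ: "P ** Q = 0" and QP: "Q ** P = 0" and k: "k > 0"
    and trP: "trace P = complex_of_real s" and trQ: "trace Q = complex_of_real t"
  shows "vn_entropy (complex_of_real a \<odot> P + complex_of_real b \<odot> Q)
    = - (s * a * log 2 (a * k) + t * b * log 2 (b * k))"
proof -
  let ?M = "complex_of_real a \<odot> P + complex_of_real b \<odot> Q"
  have Mv: "?M *v v = complex_of_real a *s (P *v v) + complex_of_real b *s (Q *v v)" for v
    by (simp add: matrix_vector_mult_add_rdistrib cscale_vec)
  have PM: "P ** ?M = complex_of_real (a * k) \<odot> P" and QM: "Q ** ?M = complex_of_real (b * k) \<odot> Q"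
    by (simp_all add: matrix_add_ldistrib P Q PQ QP)
  \<comment> \<open>Applying \<open>P\<close> to the eigenvalue equation multiplies
    \<open>P *v v\<close> by \<open>p\<close> on one side and by \<open>a * k\<close> on the
    other.\<close>
  have Pv: "P *v v = 0" if "v \<in> eigenspace ?M p" "p \<noteq> a * k" for p v
  proof -
    have "P *v (?M *v v) = complex_of_real (a * k) *s (P *v v)"
      by (simp only: matrix_vector_mul_assoc PM cscale_vec)
    moreover have "?M *v v = complex_of_real p *s v"
      using that(1) by (simp add: eigenspace_def)
    ultimately have "complex_of_real p *s (P *v v) = complex_of_real (a * k) *s (P *v v)"
      by (simp only: vector_scalar_commute)
    then show ?thesis using that(2)
      by (auto simp: vec_eq_iff simp flip: of_real_mult)
  qed
  have Qv: "Q *v v = 0" if "v \<in> eigenspace ?M p" "p \<noteq> b * k" for p v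
  proof -
    have "Q *v (?M *v v) = complex_of_real (b * k) *s (Q *v v)"
      by (simp only: matrix_vector_mul_assoc QM cscale_vec)
    moreover have "?M *v v = complex_of_real p *s v"
      using that(1) by (simp add: eigenspace_def)
    ultimately have "complex_of_real p *s (Q *v v) = complex_of_real (b * k) *s (Q *v v)"
      by (simp only: vector_scalar_commute)
    then show ?thesis using that(2)
      by (auto simp: vec_eq_iff simp flip: of_real_mult)
  qed
  have "eigenspace ?M p = {0}" if "p \<noteq> 0" "p \<notin> {a * k, b * k}" for p
  proof -
    have "v = 0" if v: "v \<in> eigenspace ?M p" for v
    proof -
      have "?M *v v = 0" using Pv[OF v] Qv[OF v] \<open>p \<notin> _\<close> by (simp add: Mv)
      then show ?thesis using v \<open>p \<noteq> 0\<close> by (simp add: eigenspace_def)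
    qed
    moreover have "0 \<in> eigenspace ?M p" by (simp add: eigenspace_def)
    ultimately show ?thesis by blast
  qed
  then have ent: "vn_entropy ?M
      = - (\<Sum>p\<in>{a * k, b * k}. real (vec.dim (eigenspace ?M p)) * (p * log 2 p))"
    by (intro vn_entropy_eq_sum) auto
  have dimP: "real (vec.dim (eigenspace P k)) = s / k"
    using dim_eigenspace[OF P] k trP by (metis less_irrefl of_real_divide of_real_eq_iff of_real_of_nat_eq)
  have dimQ: "real (vec.dim (eigenspace Q k)) = t / k"
    using dim_eigenspace[OF Q] k trQ by (metis less_irrefl of_real_divide of_real_eq_iff of_real_of_nat_eq)
  show ?thesis
  proof (cases "a = b")
    \<comment> \<open>The two eigenvalues merge into one whose multiplicity is the sum;
      \<open>P + Q\<close> is again \<open>k\<close> times an idempotent.\<close>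
    case True
    have PQ2: "(P + Q) ** (P + Q) = complex_of_real k \<odot> (P + Q)"
      by (simp add: mat_distribs P Q PQ QP)
    have "trace (P + Q) = complex_of_real (s + t)" by (simp add: trace_add trP trQ)
    then have dim: "real (vec.dim (eigenspace (P + Q) k)) = (s + t) / k"
      using dim_eigenspace[OF PQ2] k by (metis less_irrefl of_real_divide of_real_eq_iff of_real_of_nat_eq)
    have "eigenspace ?M (a * k) = eigenspace (P + Q) k" if "a \<noteq> 0"
    proof -
      have "?M *v v = complex_of_real a *s ((P + Q) *v v)" for v
        by (subst Mv) (simp add: True matrix_vector_mult_add_rdistrib vec.scale_right_distrib)
      then show ?thesis using that
        by (auto simp: eigenspace_def vec_eq_iff)
    qed
    \<comment> \<open>At \<open>a = 0\<close> the eigenspace is a kernel of unknown dimension, but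
      its term in the entropy vanishes.\<close>
    then have "a = 0 \<or> real (vec.dim (eigenspace ?M (a * k))) = (s + t) / k"
      using dim by metis
    then show ?thesis
      using k unfolding ent by (auto simp: True distrib_right add_divide_distrib)
  next
    case False
    then have ne: "a * k \<noteq> b * k" using k by simp
    have "eigenspace ?M (a * k) = eigenspace P k" if "a \<noteq> 0"
    proof (intro subset_antisym subsetI)
      fix v assume v: "v \<in> eigenspace ?M (a * k)"
      then show "v \<in> eigenspace P k"
        using Qv[OF v] ne that by (auto simp: eigenspace_def Mv vec_eq_iff)
    next
      fix v assume "v \<in> eigenspace P k"
      then have v: "P *v v = complex_of_real k *s v" by (simp add: eigenspace_def)
      have "complex_of_real k *s (Q *v v) = 0"
        using arg_cong[OF v, of "\<lambda>w. Q *v w"] QP by (simp add: matrix_vector_mul_assoc vector_scalar_commute)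
      then have "Q *v v = 0" using k by simp
      then show "v \<in> eigenspace ?M (a * k)" by (simp add: eigenspace_def Mv v)
    qed
    moreover have "eigenspace ?M (b * k) = eigenspace Q k" if "b \<noteq> 0"
    proof (intro subset_antisym subsetI)
      fix v assume v: "v \<in> eigenspace ?M (b * k)"
      then show "v \<in> eigenspace Q k"
        using Pv[OF v] ne that by (auto simp: eigenspace_def Mv vec_eq_iff)
    next
      fix v assume "v \<in> eigenspace Q k"
      then have v: "Q *v v = complex_of_real k *s v" by (simp add: eigenspace_def)
      have "complex_of_real k *s (P *v v) = 0"
        using arg_cong[OF v, of "\<lambda>w. P *v w"] PQ by (simp add: matrix_vector_mul_assoc vector_scalar_commute)
      then have "P *v v = 0" using k by simp
      then show "v \<in> eigenspace ?M (b * k)" by (simp add: eigenspace_def Mv v)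
    qed
    ultimately show ?thesis
      using k ne dimP dimQ unfolding ent by (cases "a = 0"; cases "b = 0") simp_all
  qed
qed

section \<open>Binary entropy, flat states and their mixtures\<close>

definition binary_entropy :: "real \<Rightarrow> real" where
  "binary_entropy x = - (x * log 2 x + (1 - x) * log 2 (1 - x))"

lemma binary_entropy_pos:
  assumes "0 < x" "x < 1"
  shows "binary_entropy x > 0"
proof -
  have "x * log 2 x < 0" "(1 - x) * log 2 (1 - x) < 0"
    using assms by (simp_all add: mult_less_0_iff)
  then show ?thesis by (simp add: binary_entropy_def)
qed

text \<open>All nonzero eigenvalues equal \<open>k\<close>, and trace 1 makes their number
  \<open>1 / k\<close>. This is the two-eigenvalue formula with second matrix 0.\<close>

lemma vn_entropy_flat:
  assumes "P ** P = complex_of_real k \<odot> P" "k > 0" "trace P = 1"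
  shows "vn_entropy P = - log 2 k"
  using vn_entropy_two[of P k 0 1 0 1 0] assms by (simp add: trace_def)

text \<open>Grouping rule for the entropy: orthogonal parts of equal entropy contribute it once, and
  the choice between them adds \<open>binary_entropy x\<close>.\<close>

lemma vn_entropy_mixture:
  assumes "P ** P = complex_of_real k \<odot> P" "Q ** Q = complex_of_real k \<odot> Q" "k > 0"
    and "P ** Q = 0" "Q ** P = 0" "trace P = 1" "trace Q = 1" and x: "0 \<le> x" "x \<le> 1"
  shows "vn_entropy (complex_of_real x \<odot> P + complex_of_real (1 - x) \<odot> Q) = binary_entropy x - log 2 k"
proof -
  \<comment> \<open>The logarithm of a product splits only for positive arguments; at
    \<open>y = 0\<close> both sides vanish.\<close>
  have mul: "y * log 2 (y * k) = y * log 2 y + y * log 2 k" if "y \<ge> 0" for y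
    using that \<open>k > 0\<close> by (cases "y = 0") (simp_all add: log_mult distrib_left)
  show ?thesis
    using vn_entropy_two[of P k Q 1 1 x "1 - x"] assms mul[of x] mul[of "1 - x"]
    by (simp add: binary_entropy_def algebra_simps)
qed

subsection \<open>Block matrices over the qubit T\<close>

text \<open>An index set contains \<open>None\<close> exactly when T is in state 1, so
  \<open>a\<close> is the block |0><0| of T and \<open>d\<close> the block |1><1|.\<close>

definition blk :: "'n::finite set cmat \<Rightarrow> 'n set cmat \<Rightarrow> 'n set cmat \<Rightarrow> 'n set cmat \<Rightarrow> 'n option set cmat"
  where "blk a b c d = (\<chi> x y. (if None \<in> x then if None \<in> y then d else c
     else if None \<in> y then b else a) $ (Some -` x) $ (Some -` y))"

lemma vimage_Some_image [simp]:
  "Some -` Some ` x = x" "Some -` insert None y = Some -` y" "None \<notin> Some ` x"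
  by auto

lemma option_set_cases:
  obtains y where "x = Some ` y" | y where "x = insert None (Some ` y)"
proof (cases "None \<in> x")
  case True
  have "a \<in> x \<longleftrightarrow> a \<in> insert None (Some ` (Some -` x))" for a
    using True by (cases a) auto
  then have "x = insert None (Some ` (Some -` x))" by blast
  then show ?thesis using that(2) by blast
next
  case False
  have "a \<in> x \<longleftrightarrow> a \<in> Some ` (Some -` x)" for a
    using False by (cases a) auto
  then have "x = Some ` (Some -` x)" by blast
  then show ?thesis using that(1) by blast
qed

lemma sum_option_set:
  "(\<Sum>x\<in>UNIV. F x) = (\<Sum>z\<in>UNIV. F (Some ` z)) + (\<Sum>z\<in>UNIV. F (insert None (Some ` z)))"
  for F :: "'n::finite option set \<Rightarrow> 'b::comm_monoid_add"
proof -
  have U: "UNIV = range (\<lambda>z. Some ` z :: 'n option set) \<union> range (\<lambda>z. insert None (Some ` z))"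
  proof (rule UNIV_eq_I)
    fix x :: "'n option set"
    show "x \<in> range (\<lambda>z. Some ` z) \<union> range (\<lambda>z. insert None (Some ` z))"
      by (cases x rule: option_set_cases) auto
  qed
  have inj: "inj (\<lambda>z. Some ` z :: 'n option set)" "inj (\<lambda>z. insert None (Some ` z) :: 'n option set)"
    by (auto intro!: injI dest: arg_cong[where f = "\<lambda>s. Some -` s"])
  have "(\<Sum>x\<in>UNIV. F x) = (\<Sum>x\<in>range (\<lambda>z. Some ` z). F x)
      + (\<Sum>x\<in>range (\<lambda>z. insert None (Some ` z)). F x)"
    by (subst U, rule sum.union_disjoint) auto
  then show ?thesis
    by (simp add: sum.reindex[OF inj(1)] sum.reindex[OF inj(2)])
qed

lemma option_mat_eqI:
  assumes "\<And>x y. M $ (Some ` x) $ (Some ` y) = N $ (Some ` x) $ (Some ` y)"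
    and "\<And>x y. M $ (Some ` x) $ insert None (Some ` y) = N $ (Some ` x) $ insert None (Some ` y)"
    and "\<And>x y. M $ insert None (Some ` x) $ (Some ` y) = N $ insert None (Some ` x) $ (Some ` y)"
    and "\<And>x y. M $ insert None (Some ` x) $ insert None (Some ` y)
      = N $ insert None (Some ` x) $ insert None (Some ` y)"
  shows "M = (N :: 'n::finite option set cmat)"
  unfolding mat_eq_iff
proof (intro allI)
  fix i j :: "'n option set"
  show "M $ i $ j = N $ i $ j"
    by (cases i rule: option_set_cases; cases j rule: option_set_cases) (simp_all add: assms)
qed

lemma blk_nth [simp]:
  "blk a b c d $ (Some ` x) $ (Some ` y) = a $ x $ y"
  "blk a b c d $ (Some ` x) $ insert None (Some ` y) = b $ x $ y"
  "blk a b c d $ insert None (Some ` x) $ (Some ` y) = c $ x $ y"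
  "blk a b c d $ insert None (Some ` x) $ insert None (Some ` y) = d $ x $ y"
  by (simp_all add: blk_def)

lemma blk_mult: "blk a b c d ** blk a' b' c' d'
  = blk (a ** a' + b ** c') (a ** b' + b ** d') (c ** a' + d ** c') (c ** b' + d ** d')"
  by (rule option_mat_eqI) (simp_all add: matrix_mult_nth sum_option_set)

lemma blk_add: "blk a b c d + blk a' b' c' d' = blk (a + a') (b + b') (c + c') (d + d')"
  by (rule option_mat_eqI) simp_all

lemma blk_cscale: "k \<odot> blk a b c d = blk (k \<odot> a) (k \<odot> b) (k \<odot> c) (k \<odot> d)"
  by (rule option_mat_eqI) simp_all

lemma blk_0: "blk 0 0 0 0 = 0"
  by (rule option_mat_eqI) simp_all

lemma trace_blk: "trace (blk a b c d) = trace a + trace d"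
  by (simp add: trace_def sum_option_set)

lemma blk_cong: "a = a' \<Longrightarrow> b = b' \<Longrightarrow> c = c' \<Longrightarrow> d = d' \<Longrightarrow> blk a b c d = blk a' b' c' d'"
  by simp

lemma on_qubit_blk: "on_qubit None u = blk (u $ False $ False \<odot> mat 1) (u $ False $ True \<odot> mat 1)
    (u $ True $ False \<odot> mat 1) (u $ True $ True \<odot> mat 1)"
proof (rule option_mat_eqI)
  have [simp]: "insert None (Some ` x) - {None} = Some ` x" "Some ` x - {None} = Some ` x" for x :: "'a set"
    by auto
  have [simp]: "(Some ` x = Some ` y) = (x = y)" for x y :: "'a set"
    by (simp add: inj_image_eq_iff)
qed (simp_all add: on_qubit_def mat_def inj_image_eq_iff)

lemma outer_psi_enc:
  fixes l0 l1 :: "'n::finite set cvec"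
  assumes "0 \<le> lam" "lam \<le> 1"
  shows "outer (psi_enc lam l0 l1) (psi_enc lam l0 l1)
    = blk (complex_of_real lam \<odot> outer l0 l0) (complex_of_real (sqrt (lam * (1 - lam))) \<odot> outer l0 l1)
        (complex_of_real (sqrt (lam * (1 - lam))) \<odot> outer l1 l0) (complex_of_real (1 - lam) \<odot> outer l1 l1)"
proof -
  have sq: "complex_of_real (sqrt lam) * complex_of_real (sqrt lam) = complex_of_real lam"
    "complex_of_real (sqrt (1 - lam)) * complex_of_real (sqrt (1 - lam)) = complex_of_real (1 - lam)"
    "complex_of_real (sqrt (lam * (1 - lam))) = complex_of_real (sqrt lam) * complex_of_real (sqrt (1 - lam))"
    using assms by (simp_all flip: of_real_mult add: real_sqrt_mult)
  have psi: "psi_enc lam l0 l1 $ (Some ` x) = complex_of_real (sqrt lam) * l0 $ x"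
    "psi_enc lam l0 l1 $ insert None (Some ` x) = complex_of_real (sqrt (1 - lam)) * l1 $ x" for x
    by (simp_all add: psi_enc_def tensor_T_def ket_def axis_def)
  show ?thesis
  proof (rule option_mat_eqI, goal_cases)
    case (1 x y)
    show ?case unfolding blk_nth outer_nth psi cscale_nth sq(1)[symmetric] by simp
  next
    case (2 x y)
    show ?case unfolding blk_nth outer_nth psi cscale_nth sq(3) by simp
  next
    case (3 x y)
    show ?case unfolding blk_nth outer_nth psi cscale_nth sq(3) by simp
  next
    case (4 x y)
    show ?case unfolding blk_nth outer_nth psi cscale_nth sq(2)[symmetric] by simp
  qed
qed

subsection \<open>Partial traces\<close>

lemma ptrace_nth: "ptrace R M $ x $ y
  = (if x \<subseteq> R \<and> y \<subseteq> R then \<Sum>z\<in>Pow (- R). M $ (x \<union> z) $ (y \<union> z) else 0)"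
  by (simp add: ptrace_def)

lemma ptrace_add: "ptrace R (M + N) = ptrace R M + ptrace R N"
  by (simp add: mat_eq_iff ptrace_nth sum.distrib)

lemma ptrace_cscale: "ptrace R (c \<odot> M) = c \<odot> ptrace R M"
  by (simp add: mat_eq_iff ptrace_nth sum_distrib_left)

lemma ptrace_0: "ptrace R 0 = 0"
  by (simp add: mat_eq_iff ptrace_nth)

lemma ptrace_sum: "ptrace R (\<Sum>a\<in>I. F a) = (\<Sum>a\<in>I. ptrace R (F a))"
  by (induction I rule: infinite_finite_induct) (simp_all add: ptrace_add ptrace_0)

text \<open>A subset of \<open>- R\<close> splits uniquely into a subset of \<open>R' - R\<close>
  and one of \<open>- R'\<close>, which turns the two nested sums into one.\<close>

lemma ptrace_ptrace:
  assumes "R \<subseteq> R'"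
  shows "ptrace R (ptrace R' M) = ptrace R M"
proof -
  have "(\<Sum>z\<in>Pow (- R). ptrace R' M $ (x \<union> z) $ (y \<union> z)) = (\<Sum>u\<in>Pow (- R). M $ (x \<union> u) $ (y \<union> u))"
    if xy: "x \<subseteq> R" "y \<subseteq> R" for x y
  proof -
    \<comment> \<open>Only \<open>z\<close> inside \<open>R'\<close> contribute, as
      \<open>ptrace R' M\<close> is padded with zeros elsewhere.\<close>
    have "(\<Sum>z\<in>Pow (- R). ptrace R' M $ (x \<union> z) $ (y \<union> z))
      = (\<Sum>z\<in>Pow (R' - R). ptrace R' M $ (x \<union> z) $ (y \<union> z))"
      by (rule sum.mono_neutral_right) (auto simp: ptrace_nth)
    also have "\<dots> = (\<Sum>z\<in>Pow (R' - R). \<Sum>w\<in>Pow (- R'). M $ (x \<union> (z \<union> w)) $ (y \<union> (z \<union> w)))"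
      using xy assms by (intro sum.cong) (auto simp: ptrace_nth Un_assoc)
    also have "\<dots> = (\<Sum>(z, w)\<in>Pow (R' - R) \<times> Pow (- R'). M $ (x \<union> (z \<union> w)) $ (y \<union> (z \<union> w)))"
      by (simp add: sum.cartesian_product)
    also have "\<dots> = (\<Sum>u\<in>Pow (- R). M $ (x \<union> u) $ (y \<union> u))"
      by (rule sum.reindex_bij_witness[where i = "\<lambda>u. (u \<inter> R', u - R')" and j = "\<lambda>(z, w). z \<union> w"])
        (use assms in auto)
    finally show ?thesis .
  qed
  then show ?thesis by (simp add: mat_eq_iff ptrace_nth)
qed

text \<open>Tracing out all qubits leaves a single entry, at index \<open>{}\<close>; in this form,
  trace preservation is a case of iterated partial traces.\<close>

lemma trace_eq_ptrace: "trace M = ptrace {} M $ {} $ {}"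
  by (simp add: trace_def ptrace_nth)

lemma trace_ptrace: "trace (ptrace R M) = trace M"
  by (simp add: trace_eq_ptrace ptrace_ptrace)

lemma sum_Pow_image:
  assumes "inj_on f X"
  shows "(\<Sum>z\<in>Pow (f ` X). F z) = (\<Sum>z\<in>Pow X. F (f ` z))"
  using sum.reindex[OF inj_on_image_Pow[OF assms], of F] by (simp add: image_Pow_surj)

lemma ptrace_insert_None_blk:
  "ptrace (insert None (Some ` R)) (blk a b c d) = blk (ptrace R a) (ptrace R b) (ptrace R c) (ptrace R d)"
proof -
  have "- insert None (Some ` R) = Some ` (- R)"
    by (auto simp: image_iff) (case_tac x, auto)
  then have sum: "(\<Sum>z\<in>Pow (- insert None (Some ` R)). F z) = (\<Sum>z\<in>Pow (- R). F (Some ` z))"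
    for F :: "_ \<Rightarrow> complex"
    by (simp add: sum_Pow_image)
  have sub: "Some ` x \<subseteq> insert None (Some ` R) \<longleftrightarrow> x \<subseteq> R"
    "insert None (Some ` x) \<subseteq> insert None (Some ` R) \<longleftrightarrow> x \<subseteq> R" for x
    by auto
  show ?thesis
    by (rule option_mat_eqI)
      (simp_all only: ptrace_nth sum sub blk_nth Un_insert_left image_Un[symmetric])
qed

text \<open>Tracing out T adds the two diagonal blocks; the zero blocks are the padding for indices
  that contain \<open>None\<close>.\<close>

lemma ptrace_Some_blk:
  "ptrace (Some ` R) (blk a b c d) = blk (ptrace R a + ptrace R d) 0 0 0"
proof -
  have D: "Pow (- (Some ` R)) = Pow (Some ` (- R)) \<union> insert None ` Pow (Some ` (- R))"
    (is "Pow ?C = _")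
  proof -
    have "?C = insert None (Some ` (- R))"
      by (auto simp: image_iff) (case_tac x, auto)
    then show ?thesis by (simp add: Pow_insert)
  qed
  have inj: "inj_on (insert None) (Pow (Some ` (- R)))"
    by (auto simp: inj_on_def)
  have sum: "(\<Sum>z\<in>Pow (- (Some ` R)). F z)
      = (\<Sum>z\<in>Pow (- R). F (Some ` z)) + (\<Sum>z\<in>Pow (- R). F (insert None (Some ` z)))"
    for F :: "_ \<Rightarrow> complex"
    unfolding D by (subst sum.union_disjoint) (auto simp: sum_Pow_image sum.reindex[OF inj])
  have sub: "Some ` x \<subseteq> Some ` R \<longleftrightarrow> x \<subseteq> R" "insert None (Some ` x) \<subseteq> Some ` R \<longleftrightarrow> False" for x
    by auto
  show ?thesis
    by (rule option_mat_eqI)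
      (auto simp only: ptrace_nth sum sub blk_nth Un_insert_left Un_insert_right insert_absorb2
        image_Un[symmetric] vector_add_component zero_index simp_thms if_False add_0_left split: if_splits)
qed

subsection \<open>Entropies for the possible sets of supported logical operators\<close>

lemma trace_zero_mat [simp]: "trace (0 :: 'i::finite cmat) = 0"
  by (simp add: trace_def)

lemma pauli_nths:
  "sigma_z (ket False) (ket True) $ False $ False = 1" "sigma_z (ket False) (ket True) $ False $ True = 0"
  "sigma_z (ket False) (ket True) $ True $ False = 0" "sigma_z (ket False) (ket True) $ True $ True = - 1"
  "sigma_x (ket False) (ket True) $ False $ False = 0" "sigma_x (ket False) (ket True) $ False $ True = 1"
  "sigma_x (ket False) (ket True) $ True $ False = 1" "sigma_x (ket False) (ket True) $ True $ True = 0"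
  "sigma_y (ket False) (ket True) $ False $ False = 0" "sigma_y (ket False) (ket True) $ False $ True = - \<i>"
  "sigma_y (ket False) (ket True) $ True $ False = \<i>" "sigma_y (ket False) (ket True) $ True $ True = 0"
  by (simp_all add: sigma_x_def sigma_y_def sigma_z_def ket_def axis_def)

lemma twirl_sigma_z:
  "twirl None (sigma_z (ket False) (ket True)) (blk a b c d) = blk a 0 0 d"
  by (simp add: twirl_def on_qubit_blk pauli_nths blk_mult scaleR_eq_cscale blk_cscale blk_add)
    (rule blk_cong; simp add: mat_eq_iff)

text \<open>\<open>sigma_phi\<close> is off-diagonal with entries \<open>cis (- \<phi>)\<close> and
  \<open>cis \<phi>\<close>. Conjugation with it exchanges the diagonal blocks, whose phases cancel,
  and the off-diagonal ones, which meet the same phase twice.\<close>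

lemma twirl_sigma_phi:
  "twirl None (sigma_phi (ket False) (ket True) \<phi>) (blk a b c d)
    = blk ((1/2) \<odot> (a + d)) ((1/2) \<odot> (b + (cis (- \<phi>))\<^sup>2 \<odot> c))
        ((1/2) \<odot> (c + (cis \<phi>)\<^sup>2 \<odot> b)) ((1/2) \<odot> (a + d))"
proof -
  have s: "sigma_phi (ket False) (ket True) \<phi> $ False $ False = 0"
    "sigma_phi (ket False) (ket True) \<phi> $ True $ True = 0"
    "sigma_phi (ket False) (ket True) \<phi> $ False $ True = cis (- \<phi>)"
    "sigma_phi (ket False) (ket True) \<phi> $ True $ False = cis \<phi>"
    by (simp_all add: sigma_phi_def pauli_nths complex_eq_iff)
  have 1: "cis \<phi> * cis (- \<phi>) = 1" "cis (- \<phi>) * cis \<phi> = 1"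
    by (simp_all add: cis_mult)
  show ?thesis
    unfolding twirl_def on_qubit_blk s
    by (simp add: blk_mult scaleR_eq_cscale blk_cscale blk_add)
      (rule blk_cong; simp add: mat_eq_iff 1 power2_eq_square algebra_simps)
qed

text \<open>The arguments stand for the reductions of |0_L><0_L|, |0_L><1_L|, |1_L><0_L|,
  |1_L><1_L|. They stay abstract because the entropies follow from their products and traces
  alone.\<close>

definition joint_state :: "real \<Rightarrow> 'n::finite set cmat \<Rightarrow> 'n set cmat \<Rightarrow> 'n set cmat \<Rightarrow> 'n set cmat
    \<Rightarrow> 'n option set cmat" where
  "joint_state lam a b c d = blk (complex_of_real lam \<odot> a) (complex_of_real (sqrt (lam * (1 - lam))) \<odot> b)
     (complex_of_real (sqrt (lam * (1 - lam))) \<odot> c) (complex_of_real (1 - lam) \<odot> d)"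

definition region_state :: "real \<Rightarrow> 'n::finite set cmat \<Rightarrow> 'n set cmat \<Rightarrow> 'n option set cmat" where
  "region_state lam a d = blk (complex_of_real lam \<odot> a + complex_of_real (1 - lam) \<odot> d) 0 0 0"

definition entropy_z :: "'n::finite option set cmat \<Rightarrow> real" where
  "entropy_z M = vn_entropy (twirl None (sigma_z (ket False) (ket True)) M)"

definition entropy_phi :: "real \<Rightarrow> 'n::finite option set cmat \<Rightarrow> real" where
  "entropy_phi \<phi> M = vn_entropy (twirl None (sigma_phi (ket False) (ket True) \<phi>) M)"

lemma entropy_region_state_flat:
  assumes e: "e ** e = complex_of_real k \<odot> e" and tr: "trace e = 1" and k: "k > 0"
  shows "vn_entropy (region_state lam e e) = - log 2 k"
proof -
  have eq: "region_state lam e e = blk e 0 0 0"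
    unfolding region_state_def by (rule blk_cong; simp add: mat_eq_iff algebra_simps)
  show ?thesis
    unfolding eq by (rule vn_entropy_flat) (simp_all add: blk_mult blk_cscale trace_blk trace_zero_mat e tr k)
qed

lemma entropy_region_state_orthogonal:
  assumes a: "a ** a = complex_of_real k \<odot> a" "d ** d = complex_of_real k \<odot> d"
    and ad: "a ** d = 0" "d ** a = 0" and tr: "trace a = 1" "trace d = 1" and k: "k > 0"
    and lam: "0 \<le> lam" "lam \<le> 1"
  shows "vn_entropy (region_state lam a d) = binary_entropy lam - log 2 k"
proof -
  have eq: "region_state lam a d = complex_of_real lam \<odot> blk a 0 0 0 + complex_of_real (1 - lam) \<odot> blk d 0 0 0"
    unfolding region_state_def blk_cscale blk_add by simp
  show ?thesis
    unfolding eq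
    by (rule vn_entropy_mixture) (simp_all add: blk_mult blk_cscale blk_0 trace_blk trace_zero_mat assms)
qed

lemma entropy_block_diagonal:
  assumes a: "a ** a = complex_of_real k \<odot> a" "d ** d = complex_of_real k \<odot> d"
    and tr: "trace a = 1" "trace d = 1" and k: "k > 0" and lam: "0 \<le> lam" "lam \<le> 1"
  shows "vn_entropy (blk (complex_of_real lam \<odot> a) 0 0 (complex_of_real (1 - lam) \<odot> d)) = binary_entropy lam - log 2 k"
proof -
  have eq: "blk (complex_of_real lam \<odot> a) 0 0 (complex_of_real (1 - lam) \<odot> d)
     = complex_of_real lam \<odot> blk a 0 0 0 + complex_of_real (1 - lam) \<odot> blk 0 0 0 d"
    unfolding blk_cscale blk_add by simp
  show ?thesis
    unfolding eq
    by (rule vn_entropy_mixture) (simp_all add: blk_mult blk_cscale blk_0 trace_blk trace_zero_mat assms)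
qed

text \<open>The three differences are \<open>C_R - 1\<close>, the parallel part, and the integrand
  of the perpendicular part at angle \<phi>; the later cases have the same shape. Here T and R are
  uncorrelated: the state of T is diag(lam, 1 - lam), which the \<open>sigma_z\<close> twirl leaves
  alone and the \<open>sigma_phi\<close> twirl makes maximally mixed.\<close>

lemma capacities_trivial:
  assumes e: "e ** e = complex_of_real k \<odot> e" and tr: "trace e = 1" and k: "k > 0"
    and lam: "0 \<le> lam" "lam \<le> 1"
  shows "vn_entropy (region_state lam e e) - vn_entropy (joint_state lam e 0 0 e) = - binary_entropy lam"
    and "entropy_z (joint_state lam e 0 0 e) - vn_entropy (joint_state lam e 0 0 e) = 0"
    and "entropy_phi \<phi> (joint_state lam e 0 0 e) - vn_entropy (joint_state lam e 0 0 e) = 1 - binary_entropy lam"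
proof -
  have joint: "vn_entropy (joint_state lam e 0 0 e) = binary_entropy lam - log 2 k"
    using entropy_block_diagonal[OF e e tr tr k lam] by (simp add: joint_state_def)
  show "vn_entropy (region_state lam e e) - vn_entropy (joint_state lam e 0 0 e) = - binary_entropy lam"
    by (simp add: joint entropy_region_state_flat[OF e tr k])
  show "entropy_z (joint_state lam e 0 0 e) - vn_entropy (joint_state lam e 0 0 e) = 0"
    by (simp add: entropy_z_def joint_state_def twirl_sigma_z)
  have eq: "twirl None (sigma_phi (ket False) (ket True) \<phi>) (joint_state lam e 0 0 e)
      = blk ((1/2) \<odot> e) 0 0 ((1/2) \<odot> e)" (is "_ = ?M")
    unfolding joint_state_def twirl_sigma_phi by (rule blk_cong; simp add: mat_eq_iff algebra_simps)
  \<comment> \<open>The level halves because \<open>e\<close> is spread evenly over the two states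
    of T.\<close>
  have "vn_entropy ?M = - log 2 (k / 2)"
    by (rule vn_entropy_flat) (simp_all add: blk_mult blk_cscale trace_blk e tr k)
  also have "\<dots> = 1 - log 2 k"
    using k by (simp add: log_divide)
  finally show "entropy_phi \<phi> (joint_state lam e 0 0 e) - vn_entropy (joint_state lam e 0 0 e) = 1 - binary_entropy lam"
    by (simp add: entropy_phi_def eq joint)
qed

text \<open>The level is \<open>2 * k\<close> because a surviving Z term halves the rank of the
  reduced state. The two blocks are orthogonal, so R alone determines the state of T in the
  computational basis, and T adds no entropy.\<close>

lemma capacities_Z:
  assumes a: "a ** a = complex_of_real (2 * k) \<odot> a" "d ** d = complex_of_real (2 * k) \<odot> d"
    and ad: "a ** d = 0" "d ** a = 0" and tr: "trace a = 1" "trace d = 1" and k: "k > 0"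
    and lam: "0 \<le> lam" "lam \<le> 1"
  shows "vn_entropy (region_state lam a d) - vn_entropy (joint_state lam a 0 0 d) = 0"
    and "entropy_z (joint_state lam a 0 0 d) - vn_entropy (joint_state lam a 0 0 d) = 0"
    and "entropy_phi \<phi> (joint_state lam a 0 0 d) - vn_entropy (joint_state lam a 0 0 d) = 1"
proof -
  have k2: "2 * k > 0" using k by simp
  have joint: "vn_entropy (joint_state lam a 0 0 d) = binary_entropy lam - log 2 (2 * k)"
    using entropy_block_diagonal[OF a tr k2 lam] by (simp add: joint_state_def)
  show "vn_entropy (region_state lam a d) - vn_entropy (joint_state lam a 0 0 d) = 0"
    by (simp add: joint entropy_region_state_orthogonal[OF a ad tr k2 lam])
  show "entropy_z (joint_state lam a 0 0 d) - vn_entropy (joint_state lam a 0 0 d) = 0"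
    by (simp add: entropy_z_def joint_state_def twirl_sigma_z)
  have eq: "twirl None (sigma_phi (ket False) (ket True) \<phi>) (joint_state lam a 0 0 d)
      = complex_of_real lam \<odot> blk ((1/2) \<odot> a) 0 0 ((1/2) \<odot> a)
        + complex_of_real (1 - lam) \<odot> blk ((1/2) \<odot> d) 0 0 ((1/2) \<odot> d)" (is "_ = ?M")
    unfolding joint_state_def twirl_sigma_phi blk_cscale blk_add
    by (rule blk_cong; simp add: mat_eq_iff field_simps)
  have "vn_entropy ?M = binary_entropy lam - log 2 k"
    by (rule vn_entropy_mixture) (simp_all add: blk_mult blk_cscale blk_0 trace_blk assms)
  then show "entropy_phi \<phi> (joint_state lam a 0 0 d) - vn_entropy (joint_state lam a 0 0 d) = 1"
    using k by (simp add: entropy_phi_def eq joint log_mult)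
qed

lemma sqrt_coefficient_square:
  assumes "0 \<le> lam" "lam \<le> 1"
  shows "complex_of_real (sqrt (lam * (1 - lam))) * complex_of_real (sqrt (lam * (1 - lam)))
    = complex_of_real lam * (1 - complex_of_real lam)"
proof -
  have "sqrt (lam * (1 - lam)) * sqrt (lam * (1 - lam)) = lam * (1 - lam)"
    using assms by simp
  then show ?thesis by (metis of_real_mult of_real_1 of_real_diff)
qed

text \<open>Off-diagonal entry of the spectral decomposition in \<open>capacities_X\<close>:
  \<open>t\<close> is the coefficient sqrt(lam (1 - lam)), \<open>m\<close> and \<open>m'\<close>
  are \<mu> and its conjugate in either order, and \<open>u\<close>, \<open>w\<close> are the
  inverse phases of the twirl.\<close>

lemma twirl_identity_X:
  fixes t m m' u w r x :: complex
  assumes r: "2 * r = t * (w * m + u * m')" and uw: "w * u = 1"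
  shows "t * m * x + u\<^sup>2 * (t * m') * x = (1/2 + r) * u * x - (1/2 - r) * u * x"
proof -
  have "(1/2 + r) * u * x - (1/2 - r) * u * x = (2 * r) * u * x"
    by (simp add: algebra_simps)
  also have "\<dots> = t * m * (w * u) * x + u\<^sup>2 * (t * m') * x"
    unfolding r by (simp add: power2_eq_square algebra_simps)
  finally show ?thesis by (simp add: uw)
qed
text \<open>Contribution of the off-diagonal blocks to a diagonal block of the squared twirled
  state; the twirl phases cancel because \<open>w\<close> and \<open>u\<close> are inverse.\<close>

lemma twirl_identity_full:
  fixes t L k u w x y :: complex
  assumes t: "t * t = L * (1 - L)" and uw: "w * u = 1"
  shows "t * (t * k) * x + w\<^sup>2 * t * (u\<^sup>2 * (t * k)) * y = L * (1 - L) * k * x + L * (1 - L) * k * y"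
proof -
  have "t * (t * k) * x + w\<^sup>2 * t * (u\<^sup>2 * (t * k)) * y = (t * t) * k * x + (w * u)\<^sup>2 * (t * t) * k * y"
    by (simp add: power_mult_distrib mult_ac)
  then show ?thesis by (simp add: t uw)
qed
text \<open>On the range of \<open>e\<close> the matrix \<open>v\<close> is \<open>k\<close> times a
  reflection. In each eigenspace of that reflection T is in a pure superposition of its two basis
  states, so the joint state is as flat as \<open>e\<close>; the \<open>sigma_z\<close> twirl
  destroys the superposition, and the \<open>sigma_phi\<close> twirl splits the state into two flat
  parts of unequal weight.\<close>

lemma capacities_X:
  assumes e: "e ** e = complex_of_real k \<odot> e" and tr: "trace e = 1" and k: "k > 0"
    and v: "v ** v = complex_of_real k \<odot> e" "e ** v = complex_of_real k \<odot> v" "v ** e = complex_of_real k \<odot> v"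
    and mu: "cmod \<mu> = 1" and lam: "0 \<le> lam" "lam \<le> 1"
  defines "b \<equiv> \<mu> \<odot> v" and "c \<equiv> cnj \<mu> \<odot> v"
  shows "vn_entropy (region_state lam e e) - vn_entropy (joint_state lam e b c e) = 0"
    and "entropy_z (joint_state lam e b c e) - vn_entropy (joint_state lam e b c e) = binary_entropy lam"
    and "entropy_phi \<phi> (joint_state lam e b c e) - vn_entropy (joint_state lam e b c e)
      = binary_entropy (1/2 + sqrt (lam * (1 - lam)) * Re (cis \<phi> * \<mu>))"
proof -
  have mumu: "\<mu> * cnj \<mu> = 1" "cnj \<mu> * \<mu> = 1"
    using mu complex_norm_square[of \<mu>] by (simp_all add: mult.commute)
  note ss = sqrt_coefficient_square[OF lam]
  have joint: "vn_entropy (joint_state lam e b c e) = - log 2 k"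
  proof (rule vn_entropy_flat[OF _ k])
    show "joint_state lam e b c e ** joint_state lam e b c e = complex_of_real k \<odot> joint_state lam e b c e"
      unfolding joint_state_def blk_mult blk_cscale b_def c_def
      by (intro blk_cong; simp add: mat_eq_iff e v del: mult_cancel_left mult_cancel_right; intro allI; (algebra | (insert mumu ss; algebra)))
    show "trace (joint_state lam e b c e) = 1"
      by (simp add: joint_state_def trace_blk tr)
  qed
  show "vn_entropy (region_state lam e e) - vn_entropy (joint_state lam e b c e) = 0"
    by (simp add: joint entropy_region_state_flat[OF e tr k])
  show "entropy_z (joint_state lam e b c e) - vn_entropy (joint_state lam e b c e) = binary_entropy lam"
    unfolding entropy_z_def joint_state_def twirl_sigma_z joint[unfolded joint_state_def]
    using entropy_block_diagonal[OF e e tr tr k lam] by simp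
  \<comment> \<open>The two parts have weights 1/2 + r and 1/2 - r. The phase \<mu> only shifts the
    angle.\<close>
  define r where "r = sqrt (lam * (1 - lam)) * Re (cis \<phi> * \<mu>)"
  have "\<bar>Re (cis \<phi> * \<mu>)\<bar> \<le> 1"
    using abs_Re_le_cmod[of "cis \<phi> * \<mu>"] by (simp add: norm_mult mu)
  \<comment> \<open>The inequality of arithmetic and geometric mean bounds the coefficient by 1/2,
    which keeps both weights between 0 and 1.\<close>
  moreover have "0 \<le> sqrt (lam * (1 - lam))" "sqrt (lam * (1 - lam)) \<le> 1/2"
    using arith_geo_mean_sqrt[of lam "1 - lam"] lam by auto
  ultimately have "\<bar>r\<bar> \<le> 1/2 * 1"
    unfolding r_def abs_mult by (intro mult_mono) auto
  then have r: "0 \<le> 1/2 + r" "1/2 + r \<le> 1" by auto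
  define u where "u = cis (- \<phi>)"
  define w where "w = cis \<phi>"
  have uw: "u * w = 1" "w * u = 1"
    by (simp_all add: u_def w_def cis_mult)
  have "complex_of_real (2 * Re (w * \<mu>)) = w * \<mu> + u * cnj \<mu>"
    by (simp add: u_def w_def complex_add_cnj cis_cnj[symmetric] flip: complex_cnj_mult)
  then have cr: "2 * complex_of_real r = complex_of_real (sqrt (lam * (1 - lam))) * (w * \<mu> + u * cnj \<mu>)"
    unfolding r_def w_def[symmetric] by (metis mult.left_commute of_real_mult of_real_numeral)
  \<comment> \<open>Up to scaling, \<open>?P\<close> and \<open>?Q\<close> project on the two
    eigenspaces of \<open>sigma_phi\<close> tensor \<open>v\<close> inside the range of
    \<open>e\<close>.\<close>
  let ?P = "(1/2) \<odot> blk e (u \<odot> v) (w \<odot> v) e" and ?Q = "(1/2) \<odot> blk e (- u \<odot> v) (- w \<odot> v) e"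
  have eq: "twirl None (sigma_phi (ket False) (ket True) \<phi>) (joint_state lam e b c e)
      = complex_of_real (1/2 + r) \<odot> ?P + complex_of_real (1 - (1/2 + r)) \<odot> ?Q" (is "_ = ?M")
    unfolding joint_state_def twirl_sigma_phi blk_cscale blk_add b_def c_def u_def[symmetric] w_def[symmetric]
   
  proof (rule blk_cong, goal_cases)
    case 2
    show ?case using twirl_identity_X[OF cr uw(2)] by (simp add: mat_eq_iff)
  next
    case 3
    have "2 * complex_of_real r = complex_of_real (sqrt (lam * (1 - lam))) * (u * cnj \<mu> + w * \<mu>)"
      using cr by (simp add: add.commute)
    from twirl_identity_X[OF this uw(1)] show ?case by (simp add: mat_eq_iff)
  qed (simp_all add: mat_eq_iff algebra_simps)
  have mult: "blk e (p \<odot> v) (q \<odot> v) e ** blk e (p' \<odot> v) (q' \<odot> v) e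
      = complex_of_real k \<odot> blk ((1 + p * q') \<odot> e) ((p + p') \<odot> v) ((q + q') \<odot> v) ((1 + q * p') \<odot> e)"
    for p q p' q'
    unfolding blk_mult blk_cscale by (rule blk_cong; simp add: mat_eq_iff e v algebra_simps)
  have "vn_entropy ?M = binary_entropy (1/2 + r) - log 2 k"
    by (rule vn_entropy_mixture[OF _ _ k _ _ _ _ r])
      (simp_all add: mult uw tr trace_blk, simp_all add: blk_cscale blk_0 mult.commute)
  then show "entropy_phi \<phi> (joint_state lam e b c e) - vn_entropy (joint_state lam e b c e) = binary_entropy (1/2 + sqrt (lam * (1 - lam)) * Re (cis \<phi> * \<mu>))"
    by (simp add: entropy_phi_def eq joint r_def)
qed

text \<open>Divided by \<open>2 * k\<close>, the four blocks multiply like the matrix units of the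
  2x2 matrices: R carries the whole logical qubit. The joint state is a pure state of T and that
  qubit, times a flat remainder of level \<open>2 * k\<close>; the \<open>sigma_phi\<close> twirl
  halves the level.\<close>

lemma capacities_full:
  assumes aa: "a ** a = complex_of_real (2 * k) \<odot> a" and ab: "a ** b = complex_of_real (2 * k) \<odot> b"
    and ac: "a ** c = 0" and ad: "a ** d = 0"
    and ba: "b ** a = 0" and bb: "b ** b = 0" and bc: "b ** c = complex_of_real (2 * k) \<odot> a"
    and bd: "b ** d = complex_of_real (2 * k) \<odot> b"
    and ca: "c ** a = complex_of_real (2 * k) \<odot> c" and cb: "c ** b = complex_of_real (2 * k) \<odot> d"
    and cc: "c ** c = 0" and cd: "c ** d = 0"
    and da: "d ** a = 0" and db: "d ** b = 0" and dc: "d ** c = complex_of_real (2 * k) \<odot> c"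
    and dd: "d ** d = complex_of_real (2 * k) \<odot> d"
    and tr: "trace a = 1" "trace d = 1" and k: "k > 0" and lam: "0 \<le> lam" "lam \<le> 1"
  shows "vn_entropy (region_state lam a d) - vn_entropy (joint_state lam a b c d) = binary_entropy lam"
    and "entropy_z (joint_state lam a b c d) - vn_entropy (joint_state lam a b c d) = binary_entropy lam"
    and "entropy_phi \<phi> (joint_state lam a b c d) - vn_entropy (joint_state lam a b c d) = 1"
proof -
  have k2: "2 * k > 0" using k by simp
  note rel = aa ab ac ad ba bb bc bd ca cb cc cd da db dc dd
  note ss = sqrt_coefficient_square[OF lam]
  have joint: "vn_entropy (joint_state lam a b c d) = - log 2 (2 * k)"
  proof (rule vn_entropy_flat[OF _ k2])
    show "joint_state lam a b c d ** joint_state lam a b c d = complex_of_real (2 * k) \<odot> joint_state lam a b c d"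
      unfolding joint_state_def blk_mult blk_cscale
      by (intro blk_cong; simp add: mat_eq_iff rel del: mult_cancel_left mult_cancel_right; intro allI; (algebra | (insert ss; algebra)))
    show "trace (joint_state lam a b c d) = 1"
      by (simp add: joint_state_def trace_blk tr)
  qed
  show "vn_entropy (region_state lam a d) - vn_entropy (joint_state lam a b c d) = binary_entropy lam"
    by (simp add: joint entropy_region_state_orthogonal[OF aa dd ad da tr k2 lam])
  show "entropy_z (joint_state lam a b c d) - vn_entropy (joint_state lam a b c d) = binary_entropy lam"
    unfolding entropy_z_def joint_state_def twirl_sigma_z joint[unfolded joint_state_def]
    using entropy_block_diagonal[OF aa dd tr k2 lam] by simp
  define u where "u = cis (- \<phi>)"
  define w where "w = cis \<phi>"
  have uw: "u * w = 1" "w * u = 1"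
    by (simp_all add: u_def w_def cis_mult)
  have "entropy_phi \<phi> (joint_state lam a b c d) = - log 2 k"
    unfolding entropy_phi_def
  proof (rule vn_entropy_flat[OF _ k])
    show "twirl None (sigma_phi (ket False) (ket True) \<phi>) (joint_state lam a b c d)
        ** twirl None (sigma_phi (ket False) (ket True) \<phi>) (joint_state lam a b c d)
      = complex_of_real k \<odot> twirl None (sigma_phi (ket False) (ket True) \<phi>) (joint_state lam a b c d)"
      unfolding joint_state_def twirl_sigma_phi blk_mult blk_cscale u_def[symmetric] w_def[symmetric]
    proof (rule blk_cong, goal_cases)
      case 1
      show ?case using twirl_identity_full[OF ss uw(2)]
        by (simp add: mat_eq_iff mat_distribs rel divide_simps) (simp add: algebra_simps)
    next
      case 4
      show ?case using twirl_identity_full[OF ss uw(1)]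
        by (simp add: mat_eq_iff mat_distribs rel divide_simps) (simp add: algebra_simps)
    qed (simp_all add: mat_eq_iff mat_distribs rel field_simps)
    show "trace (twirl None (sigma_phi (ket False) (ket True) \<phi>) (joint_state lam a b c d)) = 1"
      by (simp add: joint_state_def twirl_sigma_phi trace_blk trace_add tr)
  qed
  then show "entropy_phi \<phi> (joint_state lam a b c d) - vn_entropy (joint_state lam a b c d) = 1"
    using k by (simp add: joint log_mult)
qed

subsection \<open>Pauli operators\<close>

text \<open>Multiplication modulo phases is that of the Klein four-group, where two different
  nontrivial factors give the third.\<close>

definition pauli_mul :: "pauli \<Rightarrow> pauli \<Rightarrow> pauli" where
  "pauli_mul a b = (if a = PI then b else if b = PI then a else if a = b then PI
     else if PX \<notin> {a, b} then PX else if PY \<notin> {a, b} then PY else PZ)"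

definition pauli_phase :: "pauli \<Rightarrow> pauli \<Rightarrow> complex" where
  "pauli_phase a b = (if a = PI \<or> b = PI \<or> a = b then 1
     else if (a, b) \<in> {(PX, PY), (PY, PZ), (PZ, PX)} then \<i> else - \<i>)"

lemma pauli_mat_mult: "pauli_mat a ** pauli_mat b = pauli_phase a b \<odot> pauli_mat (pauli_mul a b)"
  by (cases a; cases b)
    (simp_all add: pauli_mul_def pauli_phase_def mat_eq_iff matrix_mult_nth UNIV_bool pauli_nths mat_def all_bool_eq)

lemma pauli_mul_self: "pauli_mul a a = PI" "pauli_phase a a = 1"
  by (simp_all add: pauli_mul_def pauli_phase_def)

lemma phases_mult: "a \<in> phases \<Longrightarrow> b \<in> phases \<Longrightarrow> a * b \<in> phases"
  by (auto simp: phases_def)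

lemma phases_1: "1 \<in> phases"
  by (simp add: phases_def)

lemma phases_prod: "(\<And>q. q \<in> I \<Longrightarrow> F q \<in> phases) \<Longrightarrow> (\<Prod>q\<in>I. F q) \<in> phases"
  by (induction I rule: infinite_finite_induct) (simp_all add: phases_mult phases_1)

text \<open>Distributive law: choosing one of two summands at each \<open>q\<close> amounts to
  choosing the set \<open>z\<close> where the \<open>True\<close> summand is taken. It evaluates
  sums over basis states of tensor products qubit by qubit.\<close>

lemma sum_Pow_prod:
  assumes "finite A"
  shows "(\<Sum>z\<in>Pow A. \<Prod>q\<in>A. F q (q \<in> z)) = (\<Prod>q\<in>A. F q True + F q False :: complex)"
proof -
  have "(\<Prod>q\<in>A. F q (q \<in> z)) = (\<Prod>q\<in>z. F q True) * (\<Prod>q\<in>A - z. F q False)" if "z \<in> Pow A" for z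
  proof -
    have "(\<Prod>q\<in>A. F q (q \<in> z)) = (\<Prod>q\<in>A - z. F q (q \<in> z)) * (\<Prod>q\<in>z. F q (q \<in> z))"
      using that assms by (intro prod.subset_diff) auto
    then show ?thesis by (simp add: mult.commute)
  qed
  then show ?thesis
    using prod_add[OF assms, of "\<lambda>q. F q True" "\<lambda>q. F q False"] by simp
qed

lemma pauli_op_nth: "pauli_op c f $ x $ y = c * (\<Prod>q\<in>UNIV. pauli_mat (f q) $ (q \<in> x) $ (q \<in> y))"
  by (simp add: pauli_op_def)

lemma pauli_op_cscale: "d \<odot> pauli_op c f = pauli_op (d * c) f"
  by (simp add: mat_eq_iff pauli_op_nth mult.assoc)

lemma pauli_op_PI: "pauli_op c (\<lambda>_. PI) = mat c"
proof -
  have "(\<Prod>q\<in>UNIV. if (q \<in> x) = (q \<in> y) then 1 else 0 :: complex) = (if x = y then 1 else 0)"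
    for x y :: "'a set"
    by auto
  then show ?thesis by (simp add: mat_eq_iff pauli_op_nth mat_def)
qed

lemma pauli_op_mult: "pauli_op c f ** pauli_op d g
  = pauli_op (c * d * (\<Prod>q\<in>UNIV. pauli_phase (f q) (g q))) (\<lambda>q. pauli_mul (f q) (g q))"
proof -
  have "(\<Sum>w\<in>UNIV. pauli_op c f $ x $ w * pauli_op d g $ w $ y)
    = c * d * (\<Prod>q\<in>UNIV. pauli_phase (f q) (g q)) * (\<Prod>q\<in>UNIV. pauli_mat (pauli_mul (f q) (g q)) $ (q \<in> x) $ (q \<in> y))"
    for x y
  proof -
    let ?F = "\<lambda>q b. pauli_mat (f q) $ (q \<in> x) $ b * pauli_mat (g q) $ b $ (q \<in> y)"
    have "(\<Sum>w\<in>UNIV. pauli_op c f $ x $ w * pauli_op d g $ w $ y)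
      = c * d * (\<Sum>w\<in>Pow UNIV. \<Prod>q\<in>UNIV. ?F q (q \<in> w))"
      by (simp add: pauli_op_nth sum_distrib_left prod.distrib mult_ac)
    also have "\<dots> = c * d * (\<Prod>q\<in>UNIV. ?F q True + ?F q False)"
      using sum_Pow_prod[of UNIV ?F] by simp
    also have "\<dots> = c * d * (\<Prod>q\<in>UNIV. (pauli_mat (f q) ** pauli_mat (g q)) $ (q \<in> x) $ (q \<in> y))"
      by (simp add: matrix_mult_nth UNIV_bool add.commute)
    finally show ?thesis by (simp add: pauli_mat_mult prod.distrib mult.assoc)
  qed
  then show ?thesis by (simp add: mat_eq_iff matrix_mult_nth pauli_op_nth)
qed

lemma adj_pauli_mat: "cnj (pauli_mat a $ i $ j) = pauli_mat a $ j $ i"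
  by (cases a; cases i; cases j) (simp_all add: pauli_nths mat_def)

lemma adj_pauli_op: "adj (pauli_op c f) = pauli_op (cnj c) f"
  by (simp add: mat_eq_iff pauli_op_nth adj_pauli_mat)

lemma pauli_op_square: "pauli_op c f ** pauli_op d f = mat (c * d)"
  by (simp add: pauli_op_mult pauli_mul_self pauli_op_PI)

section \<open>Pauli operators confined to a region, and their partial traces\<close>

definition pauli_on :: "'q::finite set \<Rightarrow> 'q set cmat \<Rightarrow> bool" where
  "pauli_on R P \<longleftrightarrow> (\<exists>c\<in>phases. \<exists>f. P = pauli_op c f \<and> (\<forall>q. q \<notin> R \<longrightarrow> f q = PI))"

lemma carrier_pauli_group: "P \<in> carrier pauli_group \<longleftrightarrow> pauli_on UNIV P"
  by (auto simp: pauli_group_def pauli_on_def)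

lemma mult_pauli_group [simp]: "P \<otimes>\<^bsub>pauli_group\<^esub> Q = P ** Q"
  and one_pauli_group [simp]: "\<one>\<^bsub>pauli_group\<^esub> = mat 1"
  by (simp_all add: pauli_group_def)

lemma pauli_on_mult:
  assumes "pauli_on R P" "pauli_on R Q"
  shows "pauli_on R (P ** Q)"
proof -
  obtain c f d g where P: "c \<in> phases" "P = pauli_op c f" "\<forall>q. q \<notin> R \<longrightarrow> f q = PI"
    and Q: "d \<in> phases" "Q = pauli_op d g" "\<forall>q. q \<notin> R \<longrightarrow> g q = PI"
    using assms unfolding pauli_on_def by blast
  have "c * d * (\<Prod>q\<in>UNIV. pauli_phase (f q) (g q)) \<in> phases"
    by (intro phases_mult phases_prod P Q) (auto simp: pauli_phase_def phases_def)
  moreover have "\<forall>q. q \<notin> R \<longrightarrow> pauli_mul (f q) (g q) = PI"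
    using P Q by (simp add: pauli_mul_def)
  ultimately show ?thesis
    unfolding pauli_on_def using P(2) Q(2) pauli_op_mult by blast
qed

lemma pauli_on_cscale: "pauli_on R P \<Longrightarrow> c \<in> phases \<Longrightarrow> pauli_on R (c \<odot> P)"
  unfolding pauli_on_def by (metis pauli_op_cscale phases_mult)

lemma pauli_on_mono: "pauli_on R P \<Longrightarrow> R \<subseteq> R' \<Longrightarrow> pauli_on R' P"
  unfolding pauli_on_def by blast

text \<open>At each qubit at least one of the two Paulis is \<open>PI\<close>, so the tensor factors
  commute one by one.\<close>

lemma pauli_on_disjoint_commute:
  assumes "pauli_on A P" "pauli_on B Q" "A \<inter> B = {}"
  shows "P ** Q = Q ** P"
proof -
  obtain c f d g where P: "P = pauli_op c f" "\<forall>q. q \<notin> A \<longrightarrow> f q = PI"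
    and Q: "Q = pauli_op d g" "\<forall>q. q \<notin> B \<longrightarrow> g q = PI"
    using assms unfolding pauli_on_def by blast
  have "f q = PI \<or> g q = PI" for q
    using P Q assms(3) by blast
  moreover have "pauli_mul a b = pauli_mul b a" "pauli_phase a b = pauli_phase b a"
    if "a = PI \<or> b = PI" for a b
    using that by (auto simp: pauli_mul_def pauli_phase_def)
  ultimately have "pauli_mul (f q) (g q) = pauli_mul (g q) (f q)"
    "pauli_phase (f q) (g q) = pauli_phase (g q) (f q)" for q
    by blast+
  then show ?thesis
    by (simp add: P Q pauli_op_mult mult.commute)
qed

text \<open>Some qubit outside \<open>R\<close> carries a nontrivial Pauli; it is traceless, and its
  trace is a factor of every entry.\<close>

lemma ptrace_pauli_eq_0:
  assumes P: "pauli_on UNIV P" and not: "\<not> pauli_on R P"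
  shows "ptrace R P = 0"
proof -
  obtain c f where c: "c \<in> phases" and P: "P = pauli_op c f"
    using P unfolding pauli_on_def by blast
  with not obtain p where p: "p \<notin> R" "f p \<noteq> PI"
    unfolding pauli_on_def by blast
  have tr0: "pauli_mat a $ True $ True + pauli_mat a $ False $ False = 0" if "a \<noteq> PI" for a
    using that by (cases a) (simp_all add: pauli_nths)
  have "(\<Sum>z\<in>Pow (- R). pauli_op c f $ (x \<union> z) $ (y \<union> z)) = 0" if xy: "x \<subseteq> R" "y \<subseteq> R" for x y
  proof -
    have "pauli_op c f $ (x \<union> z) $ (y \<union> z)
      = c * (\<Prod>q\<in>R. pauli_mat (f q) $ (q \<in> x) $ (q \<in> y)) * (\<Prod>q\<in>- R. pauli_mat (f q) $ (q \<in> z) $ (q \<in> z))"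
      if z: "z \<in> Pow (- R)" for z
    proof -
      have "(\<Prod>q\<in>UNIV. pauli_mat (f q) $ (q \<in> x \<union> z) $ (q \<in> y \<union> z))
        = (\<Prod>q\<in>UNIV - R. pauli_mat (f q) $ (q \<in> x \<union> z) $ (q \<in> y \<union> z))
          * (\<Prod>q\<in>R. pauli_mat (f q) $ (q \<in> x \<union> z) $ (q \<in> y \<union> z))"
        by (rule prod.subset_diff) auto
      also have "(\<Prod>q\<in>UNIV - R. pauli_mat (f q) $ (q \<in> x \<union> z) $ (q \<in> y \<union> z))
        = (\<Prod>q\<in>- R. pauli_mat (f q) $ (q \<in> z) $ (q \<in> z))"
      proof (rule prod.cong)
        fix q assume "q \<in> - R"
        then have "q \<notin> x" "q \<notin> y" using xy by blast+
        then show "pauli_mat (f q) $ (q \<in> x \<union> z) $ (q \<in> y \<union> z) = pauli_mat (f q) $ (q \<in> z) $ (q \<in> z)"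
          by simp
      qed auto
      also have "(\<Prod>q\<in>R. pauli_mat (f q) $ (q \<in> x \<union> z) $ (q \<in> y \<union> z))
        = (\<Prod>q\<in>R. pauli_mat (f q) $ (q \<in> x) $ (q \<in> y))"
      proof (rule prod.cong)
        fix q assume "q \<in> R"
        then have "q \<notin> z" using z by blast
        then show "pauli_mat (f q) $ (q \<in> x \<union> z) $ (q \<in> y \<union> z) = pauli_mat (f q) $ (q \<in> x) $ (q \<in> y)"
          by simp
      qed simp
      finally show ?thesis by (simp add: pauli_op_nth mult_ac)
    qed
    then have "(\<Sum>z\<in>Pow (- R). pauli_op c f $ (x \<union> z) $ (y \<union> z))
      = c * (\<Prod>q\<in>R. pauli_mat (f q) $ (q \<in> x) $ (q \<in> y))
        * (\<Sum>z\<in>Pow (- R). \<Prod>q\<in>- R. pauli_mat (f q) $ (q \<in> z) $ (q \<in> z))"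
      by (simp add: sum_distrib_left)
    also have "(\<Sum>z\<in>Pow (- R). \<Prod>q\<in>- R. pauli_mat (f q) $ (q \<in> z) $ (q \<in> z))
      = (\<Prod>q\<in>- R. pauli_mat (f q) $ True $ True + pauli_mat (f q) $ False $ False)"
      using sum_Pow_prod[of "- R" "\<lambda>q b. pauli_mat (f q) $ b $ b"] by simp
    also have "\<dots> = 0"
      by (rule prod_zero) (use p tr0 in auto)
    finally show ?thesis by simp
  qed
  then show ?thesis by (simp add: P mat_eq_iff ptrace_nth)
qed

lemma pauli_on_nth:
  assumes "pauli_on R K"
  shows "K $ x $ y = (if x - R = y - R then K $ (x \<inter> R) $ (y \<inter> R) else 0)"
proof -
  obtain c f where K: "K = pauli_op c f" and f: "\<forall>q. q \<notin> R \<longrightarrow> f q = PI"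
    using assms unfolding pauli_on_def by blast
  show ?thesis
  proof (cases "x - R = y - R")
    case True
    have "pauli_mat (f q) $ (q \<in> x) $ (q \<in> y) = pauli_mat (f q) $ (q \<in> x \<inter> R) $ (q \<in> y \<inter> R)" for q
    proof (cases "q \<in> R")
      case False
      then have "q \<in> x \<longleftrightarrow> q \<in> y" using True by blast
      then show ?thesis using False f by (simp add: mat_def)
    qed simp
    then show ?thesis using True by (simp add: K pauli_op_nth)
  next
    case False
    then obtain q where "q \<notin> R" "(q \<in> x) \<noteq> (q \<in> y)" by blast
    then have "pauli_mat (f q) $ (q \<in> x) $ (q \<in> y) = 0"
      using f by (simp add: mat_def)
    then have "(\<Prod>q\<in>UNIV. pauli_mat (f q) $ (q \<in> x) $ (q \<in> y)) = 0"
      by (intro prod_zero) auto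
    then show ?thesis using False by (simp add: K pauli_op_nth)
  qed
qed

text \<open>\<open>K\<close> is a matrix on \<open>R\<close> tensored with the identity, so the
  traced index \<open>z\<close> passes through it unchanged.\<close>

lemma ptrace_mult_local:
  fixes K :: "'q::finite set cmat"
  assumes K: "pauli_on R K"
  shows "ptrace R (M ** K) = ptrace R M ** K"
proof -
  \<comment> \<open>\<open>K\<close> itself is not padded, so the zeros of the product outside
    \<open>R\<close> need an argument: a nonzero entry of \<open>K\<close> links only indices with
    the same part outside \<open>R\<close>.\<close>
  have nth0: "(ptrace R M ** K) $ x $ y = 0" if "\<not> (x \<subseteq> R \<and> y \<subseteq> R)" for x y
  proof -
    have "ptrace R M $ x $ w * K $ w $ y = 0" for w
    proof (cases "x \<subseteq> R \<and> w \<subseteq> R")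
      case True
      then have "w - R \<noteq> y - R" using that by blast
      then show ?thesis by (subst pauli_on_nth[OF K]) simp
    qed (auto simp: ptrace_nth)
    then show ?thesis by (simp only: matrix_mult_nth sum.neutral_const)
  qed
  have "(\<Sum>z\<in>Pow (- R). (M ** K) $ (x \<union> z) $ (y \<union> z)) = (ptrace R M ** K) $ x $ y"
    if xy: "x \<subseteq> R" "y \<subseteq> R" for x y
  proof -
    have "(M ** K) $ (x \<union> z) $ (y \<union> z) = (\<Sum>w\<in>Pow R. M $ (x \<union> z) $ (w \<union> z) * K $ w $ y)"
      if z: "z \<in> Pow (- R)" for z
    proof -
      have inj: "inj_on (\<lambda>w. w \<union> z) (Pow R)" using z by (auto simp: inj_on_def)
      have "(M ** K) $ (x \<union> z) $ (y \<union> z) = (\<Sum>w\<in>(\<lambda>w. w \<union> z) ` Pow R. M $ (x \<union> z) $ w * K $ w $ (y \<union> z))"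
        unfolding matrix_mult_nth
      proof (rule sum.mono_neutral_right)
        show "\<forall>w\<in>UNIV - (\<lambda>w. w \<union> z) ` Pow R. M $ (x \<union> z) $ w * K $ w $ (y \<union> z) = 0"
        proof
          fix w assume w: "w \<in> UNIV - (\<lambda>w. w \<union> z) ` Pow R"
          have "w - R \<noteq> z"
          proof
            assume "w - R = z"
            then have "w = (w \<inter> R) \<union> z" by blast
            then show False using w by blast
          qed
          moreover have "y \<union> z - R = z" using xy z by blast
          ultimately have "w - R \<noteq> y \<union> z - R" by simp
          then show "M $ (x \<union> z) $ w * K $ w $ (y \<union> z) = 0"
            by (subst pauli_on_nth[OF K]) simp
        qed
      qed auto
      also have "\<dots> = (\<Sum>w\<in>Pow R. M $ (x \<union> z) $ (w \<union> z) * K $ (w \<union> z) $ (y \<union> z))"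
        by (simp add: sum.reindex[OF inj])
      also have "\<dots> = (\<Sum>w\<in>Pow R. M $ (x \<union> z) $ (w \<union> z) * K $ w $ y)"
      proof (rule sum.cong)
        fix w assume "w \<in> Pow R"
        then have "(w \<union> z) \<inter> R = w" "(w \<union> z) - R = z" "(y \<union> z) \<inter> R = y" "(y \<union> z) - R = z"
          using xy z by blast+
        then have "K $ (w \<union> z) $ (y \<union> z) = K $ w $ y"
          by (subst pauli_on_nth[OF K]) simp
        then show "M $ (x \<union> z) $ (w \<union> z) * K $ (w \<union> z) $ (y \<union> z) = M $ (x \<union> z) $ (w \<union> z) * K $ w $ y"
          by simp
      qed simp
      finally show ?thesis .
    qed
    then have "(\<Sum>z\<in>Pow (- R). (M ** K) $ (x \<union> z) $ (y \<union> z))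
      = (\<Sum>w\<in>Pow R. (\<Sum>z\<in>Pow (- R). M $ (x \<union> z) $ (w \<union> z)) * K $ w $ y)"
      by (simp add: sum_distrib_right) (rule sum.swap)
    also have "\<dots> = (\<Sum>w\<in>Pow R. ptrace R M $ x $ w * K $ w $ y)"
      using xy by (intro sum.cong) (auto simp: ptrace_nth)
    also have "\<dots> = (ptrace R M ** K) $ x $ y"
      unfolding matrix_mult_nth by (rule sum.mono_neutral_left) (auto simp: ptrace_nth)
    finally show ?thesis .
  qed
  then show ?thesis
    using nth0 by (simp add: mat_eq_iff ptrace_nth[of R "M ** K"])
qed

lemma ptrace_adj: "ptrace R (adj M) = adj (ptrace R M)"
  by (simp add: mat_eq_iff ptrace_nth)

lemma pauli_on_adj: "pauli_on R K \<Longrightarrow> pauli_on R (adj K)"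
  unfolding pauli_on_def by (auto simp: adj_pauli_op phases_def)

lemma adj_adj [simp]: "adj (adj M) = M"
  by (simp add: mat_eq_iff)

lemma ptrace_local_mult: "pauli_on R K \<Longrightarrow> ptrace R (K ** M) = K ** ptrace R M"
  using arg_cong[OF ptrace_mult_local[of R "adj K" "adj M"], of adj]
  by (simp add: pauli_on_adj adj_mult ptrace_adj flip: adj_mult)

text \<open>Because of the padding, \<open>ptrace R (mat 1)\<close> is a multiple of the projector
  on the indices inside \<open>R\<close>; every reduced operator absorbs that projector.\<close>

lemma ptrace_mult_ptrace_1:
  "ptrace R M ** ptrace R (mat 1) = 2 ^ card (- R) \<odot> ptrace R M"
proof -
  have "(\<Sum>z\<in>Pow (- R). mat 1 $ (w \<union> z) $ (y \<union> z) :: complex) = (if w = y then 2 ^ card (- R) else 0)"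
    if "w \<subseteq> R" "y \<subseteq> R" for w y
  proof -
    have "w \<union> z = y \<union> z \<longleftrightarrow> w = y" if "z \<in> Pow (- R)" for z
      using that \<open>w \<subseteq> R\<close> \<open>y \<subseteq> R\<close> by blast
    then have "(\<Sum>z\<in>Pow (- R). mat 1 $ (w \<union> z) $ (y \<union> z) :: complex) = (\<Sum>z\<in>Pow (- R). if w = y then 1 else 0)"
      by (intro sum.cong) (auto simp: mat_def)
    then show ?thesis by (simp add: card_Pow)
  qed
  then have one: "ptrace R (mat 1) $ w $ y = (if w = y then if y \<subseteq> R then 2 ^ card (- R) else 0 else 0)" for w y
    by (auto simp: ptrace_nth)
  have "(ptrace R M ** ptrace R (mat 1)) $ x $ y = 2 ^ card (- R) * ptrace R M $ x $ y" for x y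
  proof -
    have "ptrace R M $ x $ w * ptrace R (mat 1) $ w $ y = (if w = y then 2 ^ card (- R) * ptrace R M $ x $ y else 0)" for w
      unfolding one by (auto simp: ptrace_nth)
    then show ?thesis by (simp add: matrix_mult_nth)
  qed
  then show ?thesis by (simp add: mat_eq_iff)
qed

subsection \<open>Stabilizer groups\<close>

lemma mat_minus_1: "mat (- 1) = - (mat 1 :: 'i::finite cmat)"
  by (simp add: mat_eq_iff mat_def)

locale pauli_stabilizer =
  fixes S :: "'n::finite set cmat set"
  assumes S_pauli: "s \<in> S \<Longrightarrow> pauli_on UNIV s"
    and S_mult: "s \<in> S \<Longrightarrow> t \<in> S \<Longrightarrow> s ** t \<in> S"
    and S_one: "mat 1 \<in> S"
    and S_commute: "s \<in> S \<Longrightarrow> t \<in> S \<Longrightarrow> s ** t = t ** s"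
    and S_minus_one: "- mat 1 \<notin> S"
begin

text \<open>Were the phase \<i> or -\<i>, the square of \<open>s\<close> would put
  \<open>- mat 1\<close> into \<open>S\<close>.\<close>

lemma S_form:
  assumes "s \<in> S"
  obtains c f where "s = pauli_op c f" "c = 1 \<or> c = - 1"
proof -
  obtain c f where s: "s = pauli_op c f" and c: "c \<in> phases"
    using S_pauli[OF assms] unfolding pauli_on_def by blast
  have "mat (c * c) \<in> S"
    using S_mult[OF assms assms] by (simp add: s pauli_op_square)
  then have "c * c \<noteq> - 1"
    using S_minus_one mat_minus_1 by metis
  then have "c = 1 \<or> c = - 1" using c by (auto simp: phases_def)
  then show ?thesis using that s by blast
qed

lemma S_square: "s \<in> S \<Longrightarrow> s ** s = mat 1"
  by (erule S_form) (auto simp: pauli_op_square)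

lemma S_adj: "s \<in> S \<Longrightarrow> adj s = s"
  by (erule S_form) (auto simp: adj_pauli_op)

text \<open>A Pauli operator with nonzero trace is a phase times the identity, and
  \<open>mat 1\<close> is the only such operator in \<open>S\<close>.\<close>

lemma S_trace:
  assumes s: "s \<in> S" and ne: "s \<noteq> mat 1"
  shows "trace s = 0"
proof -
  have "\<not> pauli_on {} s"
  proof
    assume "pauli_on {} s"
    then obtain c where c: "c \<in> phases" "s = mat c"
      unfolding pauli_on_def by (metis (full_types) emptyE pauli_op_PI ext)
    then have "s ** s = mat (c * c)"
      by (simp add: mat_eq_cscale[of c] mat_eq_cscale[of "c * c"])
    then have "mat (c * c) \<in> S" using S_mult[OF s s] by simp
    then have "c * c \<noteq> - 1"
      using S_minus_one mat_minus_1 by metis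
    moreover have "c \<noteq> - 1" using c s S_minus_one mat_minus_1 by metis
    ultimately show False using c ne by (auto simp: phases_def)
  qed
  then have "ptrace {} s = 0" using S_pauli[OF s] by (rule ptrace_pauli_eq_0[rotated])
  then show ?thesis by (simp add: trace_eq_ptrace)
qed

text \<open>\<open>generate\<close> refers to inverses. Stabilizers are involutions, so uniqueness
  of the inverse can be checked directly on the definition of \<open>m_inv\<close>.\<close>

lemma S_inv: "s \<in> S \<Longrightarrow> inv\<^bsub>pauli_group\<^esub> s = s"
  unfolding m_inv_def
proof (rule the_equality)
  fix y assume s: "s \<in> S" and "y \<in> carrier pauli_group \<and> s \<otimes>\<^bsub>pauli_group\<^esub> y = \<one>\<^bsub>pauli_group\<^esub>
    \<and> y \<otimes>\<^bsub>pauli_group\<^esub> s = \<one>\<^bsub>pauli_group\<^esub>"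
  then have "s ** y = mat 1" by simp
  then have "s ** (s ** y) = s" by simp
  then show "y = s" by (simp add: matrix_mul_assoc S_square[OF s])
qed (simp add: carrier_pauli_group S_pauli S_square)

lemma generate_subset_S:
  assumes "G \<subseteq> S" "h \<in> generate pauli_group G"
  shows "h \<in> S"
  using assms(2) by induction (use assms(1) in \<open>auto simp: S_one S_inv S_mult\<close>)

lemma generate_one: "mat 1 \<in> generate pauli_group G"
  using generate.one[of pauli_group G] by simp

lemma generate_mult: "g \<in> generate pauli_group G \<Longrightarrow> h \<in> generate pauli_group G \<Longrightarrow> g ** h \<in> generate pauli_group G"
  using generate.eng[of g pauli_group G h] by simp

lemma generate_mono_set: "h \<in> generate pauli_group G \<Longrightarrow> G \<subseteq> G' \<Longrightarrow> h \<in> generate pauli_group G'"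
  by (induction rule: generate.induct) (auto intro: generate.intros simp: generate_one generate_mult)

text \<open>\<open>g\<close> is an involution that commutes with the rest, so in any product its
  occurrences can be collected in front and cancelled in pairs.\<close>

lemma generate_insert:
  assumes g: "g \<in> S" and G: "G \<subseteq> S"
  shows "generate pauli_group (insert g G) = generate pauli_group G \<union> (**) g ` generate pauli_group G"
    (is "?L = ?H \<union> _")
proof (intro subset_antisym subsetI)
  have one: "mat 1 \<in> ?H" using generate.one[of pauli_group G] by simp
  fix h assume "h \<in> ?L"
  then show "h \<in> ?H \<union> (**) g ` ?H"
  proof induction
    case one
    then show ?case using \<open>mat 1 \<in> ?H\<close> by simp
  next
    case (incl h)
    then show ?case using one by (auto intro: generate.incl intro!: image_eqI[of _ _ "mat 1"])
  next
    case (inv h)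
    then have "inv\<^bsub>pauli_group\<^esub> h = h" using g G by (intro S_inv) auto
    then show ?case using inv one by (auto intro: generate.incl intro!: image_eqI[of _ _ "mat 1"])
  next
    \<comment> \<open>\<open>binary_entropy\<close> is here only the local name of the second
      factor, a matrix.\<close>
    case (eng h1 binary_entropy)
    have "\<exists>u\<in>?H. h = u \<or> h = g ** u" if "h \<in> ?H \<union> (**) g ` ?H" for h
      using that by blast
    then obtain u v where u: "u \<in> ?H" "h1 = u \<or> h1 = g ** u" and v: "v \<in> ?H" "binary_entropy = v \<or> binary_entropy = g ** v"
      using eng.IH by meson
    have comm: "u ** g = g ** u" using S_commute g generate_subset_S[OF G u(1)] by blast
    have ugv: "u ** (g ** v) = g ** (u ** v)"
      by (simp only: matrix_mul_assoc comm)
    moreover have "g ** u ** (g ** v) = (g ** g) ** (u ** v)"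
      using ugv by (simp flip: matrix_mul_assoc)
    ultimately have "u ** (g ** v) = g ** (u ** v)" "g ** u ** (g ** v) = u ** v"
      by (simp_all add: S_square[OF g])
    then have "h1 ** binary_entropy = u ** v \<or> h1 ** binary_entropy = g ** (u ** v)"
      using u(2) v(2) by (auto simp flip: matrix_mul_assoc)
    then show ?case using generate_mult[OF u(1) v(1)] by auto
  qed
next
  fix h assume "h \<in> ?H \<union> (**) g ` ?H"
  moreover have "g \<in> ?L" by (simp add: generate.incl)
  ultimately show "h \<in> ?L"
    using generate_mono_set[of _ G "insert g G"] generate_mult by auto
qed

text \<open>Each new generator doubles the group: with H the group generated so far, the new one is
  the union of H and gH, and a common element would put \<open>g\<close> into H.\<close>

lemma card_generate:
  assumes "finite G" "G \<subseteq> S" "independent_gens G"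
  shows "finite (generate pauli_group G) \<and> card (generate pauli_group G) = 2 ^ card G"
  using assms
proof (induction G)
  case empty
  have "h = mat 1" if "h \<in> generate pauli_group {}" for h :: "'n set cmat"
    using that by induction auto
  moreover have "mat 1 \<in> generate (pauli_group :: 'n set cmat monoid) {}"
    using generate.one[of pauli_group "{}"] by simp
  ultimately have "generate (pauli_group :: 'n set cmat monoid) {} = {mat 1}" by blast
  then show ?case by simp
next
  case (insert g G)
  let ?H = "generate pauli_group G"
  have g: "g \<in> S" and G: "G \<subseteq> S" using insert.prems by auto
  have "independent_gens G"
    unfolding independent_gens_def
  proof (intro ballI notI)
    fix x assume x: "x \<in> G" "x \<in> generate pauli_group (G - {x})"
    then have "x \<in> generate pauli_group (insert g G - {x})"
      by (elim generate_mono_set) auto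
    then show False using insert.prems(2) x(1) unfolding independent_gens_def by blast
  qed
  then have IH: "finite ?H" "card ?H = 2 ^ card G" using insert.IH[OF G] by auto
  have gH: "g \<notin> ?H"
    using insert.prems(2) insert.hyps(2) unfolding independent_gens_def by simp
  have inj: "inj_on ((**) g) ?H"
  proof (rule inj_onI)
    fix u v assume "g ** u = g ** v"
    then have "g ** g ** u = g ** g ** v" by (metis matrix_mul_assoc)
    then show "u = v" by (simp add: S_square[OF g])
  qed
  have disj: "?H \<inter> (**) g ` ?H = {}"
  proof (rule equals0I)
    fix h assume "h \<in> ?H \<inter> (**) g ` ?H"
    then obtain u where u: "u \<in> ?H" "g ** u \<in> ?H" by blast
    then have "g ** u ** u \<in> ?H" using generate_mult by blast
    moreover have "g ** u ** u = g"
      using S_square generate_subset_S[OF G u(1)] by (simp flip: matrix_mul_assoc)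
    ultimately show False using gH by simp
  qed
  show ?case
    using IH insert.hyps
    by (simp add: generate_insert[OF g G] card_Un_disjoint[OF _ _ disj] card_image[OF inj])
qed

end

text \<open>\<open>card\<close> of an infinite set is 0, so the prescribed number of generators does
  not by itself make the generating set finite; finiteness of the whole group does.\<close>

lemma finite_carrier_pauli_group: "finite (carrier (pauli_group :: 'q::finite set cmat monoid))"
proof -
  have "(UNIV :: pauli set) = {PI, PX, PY, PZ}" using pauli.exhaust by blast
  then have fin: "finite (UNIV :: pauli set)" by (metis finite.emptyI finite_insert)
  have "finite (PiE (UNIV :: 'q set) (\<lambda>_. UNIV :: pauli set))"
    by (rule finite_PiE) (use fin in auto)
  then have "finite (UNIV :: ('q \<Rightarrow> pauli) set)" by (simp add: PiE_UNIV_domain)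
  then have "finite ((\<lambda>(c, f). pauli_op c f) ` (phases \<times> (UNIV :: ('q \<Rightarrow> pauli) set)))"
    by (intro finite_imageI finite_cartesian_product) (simp_all add: phases_def)
  moreover have "carrier (pauli_group :: 'q set cmat monoid) = (\<lambda>(c, f). pauli_op c f) ` (phases \<times> UNIV)"
    by (auto simp: pauli_group_def)
  ultimately show ?thesis by simp
qed

text \<open>\<open>CARD('n set)\<close> is the dimension of the Hilbert space, so this is the count
  2^(n-1) that belongs to n-1 independent generators.\<close>

locale qubit_code = pauli_stabilizer S for S :: "'n::finite set cmat set" +
  assumes S_card: "2 * card S = CARD('n set)"

lemma stabilizer_code_imp_qubit_code:
  fixes S :: "'n::finite set cmat set"
  assumes "stabilizer_code S d"
  shows "qubit_code S"
proof -
  have sub: "subgroup S pauli_group" and comm: "\<And>s. s \<in> S \<Longrightarrow> commutes_with s S" and "- mat 1 \<notin> S"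
    using assms by (auto simp: stabilizer_code_def)
  obtain G where G: "G \<subseteq> carrier pauli_group" "card G = CARD('n) - 1" "independent_gens G"
    "generate pauli_group G = S"
    using assms by (auto simp: stabilizer_code_def)
  interpret pauli_stabilizer S
  proof
    show "pauli_on UNIV s" if "s \<in> S" for s
      using that subgroup.subset[OF sub] carrier_pauli_group by blast
    show "s ** t \<in> S" if "s \<in> S" "t \<in> S" for s t
      using subgroup.m_closed[OF sub that] by simp
    show "mat 1 \<in> S" using subgroup.one_closed[OF sub] by simp
    show "s ** t = t ** s" if "s \<in> S" "t \<in> S" for s t
      using comm[OF that(1)] that(2) by (simp add: commutes_with_def)
  qed fact
  have "finite G" using G(1) finite_carrier_pauli_group finite_subset by blast
  moreover have "G \<subseteq> S" unfolding G(4)[symmetric] by (intro subsetI generate.incl)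
  ultimately have "card S = 2 ^ (CARD('n) - 1)"
    using card_generate[of G] G by auto
  moreover have "CARD('n set) = 2 ^ CARD('n)"
    using card_Pow[of "UNIV :: 'n set"] by simp
  moreover have "CARD('n) > 0" by simp
  ultimately have "2 * card S = CARD('n set)"
    by (simp flip: power_Suc)
  then show ?thesis by unfold_locales
qed

text \<open>The trace is the squared Hilbert-Schmidt norm of \<open>M\<close>.\<close>

lemma eq_0_if_trace_mult_adj:
  assumes "trace (M ** adj M) = 0"
  shows "M = 0"
proof -
  have "trace (M ** adj M) = (\<Sum>i\<in>UNIV. \<Sum>j\<in>UNIV. complex_of_real ((cmod (M $ i $ j))\<^sup>2))"
    by (simp add: trace_def matrix_mult_nth complex_norm_square del: of_real_power)
  also have "\<dots> = complex_of_real (\<Sum>i\<in>UNIV. \<Sum>j\<in>UNIV. (cmod (M $ i $ j))\<^sup>2)"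
    by simp
  finally have "(\<Sum>i\<in>UNIV. \<Sum>j\<in>UNIV. (cmod (M $ i $ j))\<^sup>2) = 0"
    using assms by (metis of_real_eq_0_iff)
  then show ?thesis
    by (simp add: sum_nonneg_eq_0_iff sum_nonneg mat_eq_iff)
qed

lemma trace_outer: "trace (outer u v) = (\<Sum>i\<in>UNIV. u $ i * cnj (v $ i))"
  by (simp add: trace_def)

lemma trace_outer_self: "trace (outer u u) = complex_of_real ((norm u)\<^sup>2)"
  by (simp only: trace_outer norm_vec_square)

text \<open>Subtracting |u><u| leaves a Hermitian idempotent of trace 0, hence one of
  Hilbert-Schmidt norm 0.\<close>

lemma rank_one_projector_eq_outer:
  assumes P: "P ** P = P" "adj P = P" "trace P = 1" and u: "P *v u = u" "norm u = 1"
  shows "P = outer u u"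
proof -
  let ?Q = "P - outer u u"
  have "outer u u ** outer u u = outer u u"
  proof -
    have "(\<Sum>k\<in>UNIV. u $ i * cnj (u $ k) * (u $ k * cnj (u $ j))) = u $ i * cnj (u $ j)" for i j
    proof -
      have "(\<Sum>k\<in>UNIV. u $ i * cnj (u $ k) * (u $ k * cnj (u $ j)))
        = u $ i * cnj (u $ j) * (\<Sum>k\<in>UNIV. u $ k * cnj (u $ k))"
        by (simp add: sum_distrib_left mult_ac)
      then show ?thesis by (simp add: norm_vec_square u)
    qed
    then show ?thesis by (simp add: mat_eq_iff matrix_mult_nth)
  qed
  moreover have "P ** outer u u = outer u u" "outer u u ** P = outer u u"
    by (simp_all add: outer_mult_left outer_mult_right P u)
  ultimately have "?Q ** ?Q = ?Q"
    by (simp add: mult_diff_left_mat mult_diff_right_mat P)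
  moreover have "adj ?Q = ?Q"
    using P(2) by (simp add: mat_eq_iff)
  moreover have "trace ?Q = 0"
    by (simp add: trace_sub P trace_outer_self u)
  ultimately have "trace (?Q ** adj ?Q) = 0" by simp
  from eq_0_if_trace_mult_adj[OF this] show ?thesis by simp
qed

lemma mult_swap_middle:
  fixes t L :: "'i::finite cmat"
  assumes "t ** L = L ** t"
  shows "K ** t ** (L ** u) = K ** L ** (t ** u)"
proof -
  have "K ** t ** (L ** u) = K ** (t ** L) ** u" by (simp only: matrix_mul_assoc)
  also have "\<dots> = K ** L ** (t ** u)" by (simp only: assms matrix_mul_assoc)
  finally show ?thesis .
qed

lemma mat_eq_minus_self: "M = - M \<Longrightarrow> M = (0 :: 'i::finite cmat)"
  by (simp add: mat_eq_iff)

lemma mat_1_neq_0: "mat 1 \<noteq> (0 :: 'i::finite cmat)"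
  by (auto simp: mat_eq_iff mat_def)

lemma sum_const_mat: "(\<Sum>a\<in>I. M) = of_nat (card I) \<odot> M"
  by (induction I rule: infinite_finite_induct)
    (simp_all add: mat_eq_iff distrib_right del: sum_constant)

lemma sum_const_vec: "(\<Sum>a\<in>I. v) = of_nat (card I) *s (v :: 'i::finite cvec)"
  by (induction I rule: infinite_finite_induct)
    (simp_all add: vec_eq_iff distrib_right del: sum_constant)

section \<open>The reduced code projector and supported logical operators\<close>

context qubit_code
begin

text \<open>Half of the code projector, since that projector has trace 2.\<close>

definition mixed :: "'n set cmat" where
  "mixed = (1 / of_nat CARD('n set)) \<odot> (\<Sum>s\<in>S. s)"

text \<open>This is \<open>supported_on\<close> for the coset of \<open>L\<close>, phrased by a
  representative so that it can enter matrix identities.\<close>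

definition supports :: "'n set \<Rightarrow> 'n set cmat \<Rightarrow> bool" where
  "supports R L \<longleftrightarrow> (\<exists>t\<in>S. pauli_on R (L ** t))"

lemma card_S_over_dim: "of_nat (card S) / of_nat CARD('n set) = (1 / 2 :: complex)"
proof -
  have "(of_nat CARD('n set) :: complex) = 2 * of_nat (card S)"
    by (metis S_card of_nat_mult of_nat_numeral)
  moreover have "card S > 0" using S_card by (metis mult_0_right neq0_conv zero_less_card_finite)
  ultimately show ?thesis by (simp add: field_simps)
qed

lemma finite_S: "finite S"
  using card_S_over_dim by (metis card.infinite div_0 of_nat_0 zero_neq_one divide_eq_0_iff zero_neq_numeral)

text \<open>Multiplication by \<open>t\<close> permutes the summands.\<close>

lemma mixed_mult:
  assumes t: "t \<in> S"
  shows "mixed ** t = mixed" "t ** mixed = mixed"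
proof -
  have 1: "s ** t ** t = s" for s
    using S_square[OF t] by (simp flip: matrix_mul_assoc)
  have "(\<Sum>s\<in>S. s ** t) = (\<Sum>s\<in>S. s)"
    by (rule sum.reindex_bij_witness[where i = "\<lambda>s. s ** t" and j = "\<lambda>s. s ** t"])
      (auto simp: 1 S_mult t)
  then show m: "mixed ** t = mixed"
    by (simp add: mixed_def mult_sum_left_mat)
  have "(\<Sum>s\<in>S. t ** s) = (\<Sum>s\<in>S. s ** t)"
    by (rule sum.cong) (auto simp: S_commute t)
  with m show "t ** mixed = mixed"
    by (simp add: mixed_def mult_sum_left_mat mult_sum_right_mat)
qed

lemma mixed_square: "mixed ** mixed = (1/2) \<odot> mixed"
proof -
  have "mixed ** mixed = (1 / of_nat CARD('n set)) \<odot> (\<Sum>s\<in>S. mixed ** s)"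
    by (subst (2) mixed_def) (simp add: mult_sum_right_mat)
  also have "\<dots> = (1 / of_nat CARD('n set)) \<odot> (of_nat (card S) \<odot> mixed)"
    by (simp add: mixed_mult sum_const_mat[symmetric] del: sum_constant)
  also have "\<dots> = (of_nat (card S) / of_nat CARD('n set)) \<odot> mixed" by simp
  finally show ?thesis by (simp only: card_S_over_dim)
qed

lemma adj_mixed: "adj mixed = mixed"
  by (simp add: mixed_def adj_cscale adj_sum S_adj)

text \<open>All stabilizers except the identity are traceless, and the identity contributes the
  dimension.\<close>

lemma trace_mixed: "trace mixed = 1"
proof -
  have "trace (\<Sum>s\<in>S. s) = (\<Sum>s\<in>S. trace s)"
    by (simp add: trace_def) (rule sum.swap)
  also have "\<dots> = (\<Sum>s\<in>{mat 1 :: 'n set cmat}. trace s)"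
    by (rule sum.mono_neutral_right) (auto simp: finite_S S_one S_trace)
  finally show ?thesis by (simp add: mixed_def trace_I)
qed

lemma mixed_commute:
  assumes "\<And>s. s \<in> S \<Longrightarrow> L ** s = s ** L"
  shows "L ** mixed = mixed ** L"
  using assms by (simp add: mixed_def mult_sum_left_mat mult_sum_right_mat)

lemma mixed_codespace:
  assumes "v \<in> codespace S"
  shows "mixed *v v = (1/2) *s v"
proof -
  have sum: "(\<Sum>s\<in>I. s) *v v = (\<Sum>s\<in>I. s *v v)" for I :: "'n set cmat set"
    by (induction I rule: infinite_finite_induct) (simp_all add: matrix_vector_mult_add_rdistrib)
  have "(\<Sum>s\<in>S. s *v v) = (\<Sum>s\<in>S. v)"
    using assms by (intro sum.cong) (auto simp: codespace_def)
  then have "mixed *v v = (1 / of_nat CARD('n set)) *s (of_nat (card S) *s v)"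
    by (simp add: mixed_def cscale_vec sum sum_const_vec del: sum_constant)
  then show ?thesis using card_S_over_dim by simp
qed

text \<open>\<open>mixed + mixed ** W\<close> is the code projector times the projector (1 + W) / 2,
  so it has rank 1 as soon as its trace is 1; the anticommuting \<open>X\<close> provides this by
  making \<open>mixed ** W\<close> traceless. It is applied with \<open>W\<close> equal to
  \<open>Zb\<close> and to \<open>- Zb\<close>.\<close>

lemma outer_eigenvector_eq_mixed:
  assumes W: "W ** W = mat 1" "adj W = W" "\<And>s. s \<in> S \<Longrightarrow> W ** s = s ** W"
    and X: "X ** X = mat 1" "\<And>s. s \<in> S \<Longrightarrow> X ** s = s ** X" and WX: "W ** X = - (X ** W)"
    and l: "l \<in> codespace S" "norm l = 1" "W *v l = l"
  shows "outer l l = mixed + mixed ** W"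
proof -
  have Wm: "W ** mixed = mixed ** W" and Xm: "X ** mixed = mixed ** X"
    using mixed_commute W(3) X(2) by auto
  have sq: "mixed ** W ** (mixed ** W) = (1/2) \<odot> mixed" "mixed ** (mixed ** W) = (1/2) \<odot> (mixed ** W)"
    "mixed ** W ** mixed = (1/2) \<odot> (mixed ** W)"
  proof -
    show 1: "mixed ** (mixed ** W) = (1/2) \<odot> (mixed ** W)"
      by (simp add: matrix_mul_assoc mixed_square)
    show "mixed ** W ** (mixed ** W) = (1/2) \<odot> mixed"
      using mult_swap_middle[OF Wm, of mixed W] by (simp add: W(1) mixed_square)
    show "mixed ** W ** mixed = (1/2) \<odot> (mixed ** W)"
      using 1 by (simp add: Wm flip: matrix_mul_assoc)
  qed
  have "mixed + mixed ** W = outer l l"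
  proof (rule rank_one_projector_eq_outer)
    show "(mixed + mixed ** W) ** (mixed + mixed ** W) = mixed + mixed ** W"
      by (simp add: matrix_add_ldistrib mult_add_left_mat mixed_square sq) (simp add: mat_eq_iff)
    show "adj (mixed + mixed ** W) = mixed + mixed ** W"
      by (simp add: adj_add adj_mult adj_mixed W Wm)
    \<comment> \<open>Conjugation by \<open>X\<close> preserves the trace but turns \<open>W\<close>
      into \<open>- W\<close>.\<close>
    have "trace (mixed ** W) = trace (X ** (mixed ** W ** X))"
      using X(1) trace_mul_sym[of X "mixed ** W ** X"] by (simp flip: matrix_mul_assoc)
    also have "X ** (mixed ** W ** X) = (X ** mixed) ** (W ** X)"
      by (simp only: matrix_mul_assoc)
    also have "\<dots> = - (mixed ** (X ** X) ** W)"
      by (simp add: Xm WX matrix_mul_assoc)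
    also have "trace \<dots> = - trace (mixed ** W)"
      by (simp add: X trace_def sum_negf)
    finally have "trace (mixed ** W) = 0" by simp
    then show "trace (mixed + mixed ** W) = 1"
      by (simp add: trace_add trace_mixed)
    have "(mixed ** W) *v l = (1/2) *s l"
      by (simp add: mixed_codespace l flip: matrix_vector_mul_assoc)
    then show "(mixed + mixed ** W) *v l = l"
      by (simp add: matrix_vector_mult_add_rdistrib mixed_codespace l) (simp add: vec_eq_iff)
  qed (rule l)
  then show ?thesis by simp
qed

text \<open>Only stabilizers confined to \<open>R\<close> survive in the reduced
  \<open>mixed\<close>. Multiplied from the right, each of them can be moved into the partial trace,
  where \<open>mixed\<close> absorbs it, so every summand of the square is the same multiple of the
  reduced \<open>mixed\<close>.\<close>

lemma ptrace_mixed_square: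
  obtains k where "k > 0" "ptrace R mixed ** ptrace R mixed = complex_of_real k \<odot> ptrace R mixed"
proof -
  \<comment> \<open>The number of surviving stabilizers times the trace factor of the qubits outside
    \<open>R\<close>, divided by the dimension.\<close>
  define k where "k = 1 / real CARD('n set) * real (card {s \<in> S. pauli_on R s}) * 2 ^ card (- R)"
  have on1: "pauli_on R (mat 1)"
    unfolding pauli_on_def using pauli_op_PI[of 1] phases_1 by metis
  have "{s \<in> S. pauli_on R s} \<noteq> {}" using on1 S_one by blast
  then have pos: "k > 0" unfolding k_def using finite_S by (simp add: card_gt_0_iff)
  let ?f = "ptrace R mixed" and ?S = "{s \<in> S. pauli_on R s}" and ?N = "1 / of_nat CARD('n set) :: complex"
  have "(\<Sum>s\<in>S. ptrace R s) = (\<Sum>s\<in>?S. ptrace R s)"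
    by (rule sum.mono_neutral_right) (auto simp: finite_S ptrace_pauli_eq_0 S_pauli)
  also have "\<dots> = (\<Sum>s\<in>?S. ptrace R (mat 1) ** s)"
    using ptrace_mult_local[of R _ "mat 1"] by (intro sum.cong) auto
  finally have f: "?f = ?N \<odot> (\<Sum>s\<in>?S. ptrace R (mat 1) ** s)"
    by (simp add: mixed_def ptrace_cscale ptrace_sum)
  have "?f ** ptrace R (mat 1) ** s = 2 ^ card (- R) \<odot> ?f" if "s \<in> ?S" for s
    using that ptrace_mult_local[of R s mixed] by (simp add: ptrace_mult_ptrace_1 mixed_mult)
  then have "(\<Sum>s\<in>?S. ?f ** (ptrace R (mat 1) ** s)) = (\<Sum>s\<in>?S. 2 ^ card (- R) \<odot> ?f)"
    by (intro sum.cong) (auto simp: matrix_mul_assoc)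
  moreover have "?f ** ?f = ?N \<odot> (\<Sum>s\<in>?S. ?f ** (ptrace R (mat 1) ** s))"
    by (subst (2) f) (simp add: mult_sum_right_mat)
  ultimately have "?f ** ?f = complex_of_real k \<odot> ?f"
    by (simp add: k_def sum_const_mat del: sum_constant)
  then show ?thesis using that pos by blast
qed

text \<open>In the expansion of \<open>mixed ** L\<close> every term \<open>L ** s\<close> is a
  Pauli operator that reaches outside \<open>R\<close>.\<close>

lemma ptrace_mixed_mult_unsupported:
  assumes L: "pauli_on UNIV L" "\<And>s. s \<in> S \<Longrightarrow> L ** s = s ** L" and not: "\<not> supports R L"
  shows "ptrace R (mixed ** L) = 0"
proof -
  have "ptrace R (L ** s) = 0" if "s \<in> S" for s
  proof (rule ptrace_pauli_eq_0)
    show "pauli_on UNIV (L ** s)" using pauli_on_mult[OF L(1) S_pauli[OF that]] .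
    show "\<not> pauli_on R (L ** s)" using not that by (auto simp: supports_def)
  qed
  moreover have "mixed ** L = (1 / of_nat CARD('n set)) \<odot> (\<Sum>s\<in>S. L ** s)"
    using L(2) by (simp add: mixed_def mult_sum_left_mat)
  ultimately show ?thesis by (simp add: ptrace_cscale ptrace_sum)
qed

text \<open>Next to \<open>mixed\<close> the factor \<open>t\<close> is absorbed, so
  \<open>L\<close> may be exchanged for its representative \<open>L ** t\<close>, which lives on
  \<open>R\<close> and can be pulled out of the partial trace on either side.\<close>

lemma supports_rep:
  assumes "supports R L" and comm: "\<And>s. s \<in> S \<Longrightarrow> L ** s = s ** L" and sq: "L ** L = mat 1"
  obtains t where "t \<in> S" "pauli_on R (L ** t)" "(L ** t) ** (L ** t) = mat 1"
    "ptrace R (mixed ** L) = ptrace R mixed ** (L ** t)"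
    "(L ** t) ** ptrace R mixed = ptrace R mixed ** (L ** t)"
proof -
  obtain t where t: "t \<in> S" "pauli_on R (L ** t)"
    using assms(1) by (auto simp: supports_def)
  have Lm: "L ** mixed = mixed ** L" by (rule mixed_commute[OF comm])
  have 1: "mixed ** (L ** t) = mixed ** L"
    by (simp add: comm[OF t(1)] matrix_mul_assoc mixed_mult[OF t(1)])
  have 2: "(L ** t) ** mixed = mixed ** L"
    using mixed_mult[OF t(1)] Lm by (simp flip: matrix_mul_assoc)
  have "(L ** t) ** (L ** t) = mat 1"
    using mult_swap_middle[OF comm[OF t(1), symmetric], of L t] by (simp add: sq S_square t(1))
  moreover have "ptrace R (mixed ** L) = ptrace R mixed ** (L ** t)"
    using ptrace_mult_local[OF t(2), of mixed] by (simp add: 1)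
  moreover have "(L ** t) ** ptrace R mixed = ptrace R mixed ** (L ** t)"
    using ptrace_mult_local[OF t(2), of mixed] ptrace_local_mult[OF t(2), of mixed] by (simp add: 1 2)
  ultimately show ?thesis using that t by blast
qed

lemma supports_mult:
  assumes "supports R L1" "supports R L2" and L: "L3 = c \<odot> (L1 ** L2)" "c \<in> phases"
    and comm: "\<And>s. s \<in> S \<Longrightarrow> L2 ** s = s ** L2"
  shows "supports R L3"
proof -
  obtain t u where t: "t \<in> S" "pauli_on R (L1 ** t)" and u: "u \<in> S" "pauli_on R (L2 ** u)"
    using assms(1,2) by (auto simp: supports_def)
  have "L1 ** t ** (L2 ** u) = L1 ** L2 ** (t ** u)"
    using mult_swap_middle[OF comm[OF t(1), symmetric]] .
  then have "L3 ** (t ** u) = c \<odot> (L1 ** t ** (L2 ** u))" by (simp add: L)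
  then have "pauli_on R (L3 ** (t ** u))"
    using pauli_on_cscale[OF pauli_on_mult[OF t(2) u(2)] L(2)] by simp
  then show ?thesis using S_mult t(1) u(1) by (auto simp: supports_def)
qed

lemma supports_mono: "supports R L \<Longrightarrow> R \<subseteq> R' \<Longrightarrow> supports R' L"
  unfolding supports_def using pauli_on_mono by blast

text \<open>The representatives act on disjoint qubits and commute. Their stabilizer factors cancel,
  so \<open>L1\<close> and \<open>L2\<close> would commute as well as anticommute, which is
  impossible for involutions.\<close>

lemma anticommuting_not_supported_disjoint:
  assumes "supports A L1" "supports B L2" "A \<inter> B = {}"
    and anti: "L1 ** L2 = - (L2 ** L1)" and sq: "L1 ** L1 = mat 1" "L2 ** L2 = mat 1"
    and comm: "\<And>s. s \<in> S \<Longrightarrow> L1 ** s = s ** L1" "\<And>s. s \<in> S \<Longrightarrow> L2 ** s = s ** L2"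
  shows False
proof -
  obtain t u where t: "t \<in> S" "pauli_on A (L1 ** t)" and u: "u \<in> S" "pauli_on B (L2 ** u)"
    using assms(1,2) by (auto simp: supports_def)
  have "L1 ** t ** (L2 ** u) = L2 ** u ** (L1 ** t)"
    by (rule pauli_on_disjoint_commute[OF t(2) u(2) assms(3)])
  then have "L1 ** L2 ** (t ** u) = L2 ** L1 ** (t ** u)"
    using mult_swap_middle[OF comm(2)[OF t(1), symmetric], of L1 u]
      mult_swap_middle[OF comm(1)[OF u(1), symmetric], of L2 t] S_commute[OF t(1) u(1)] by simp
  then have "L1 ** L2 ** ((t ** u) ** (t ** u)) = L2 ** L1 ** ((t ** u) ** (t ** u))"
    by (simp only: matrix_mul_assoc)
  then have "L1 ** L2 = L2 ** L1"
    using S_square[OF S_mult[OF t(1) u(1)]] by simp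
  then have "L2 ** L1 = 0" using anti mat_eq_minus_self by metis
  then have "L2 ** (L2 ** L1) ** L1 = 0" by simp
  then have "(L2 ** L2) ** (L1 ** L1) = 0" by (simp only: matrix_mul_assoc)
  then show False using sq by (simp add: mat_1_neq_0)
qed

end

subsection \<open>The encoded state\<close>

text \<open>When \<open>b\<close>, \<open>c\<close>, \<open>d\<close> arise from \<open>a\<close> by
  multiplication with an involution \<open>X\<close>, the sixteen products required of scaled matrix
  units all follow from \<open>aa\<close> and \<open>aXa\<close>.\<close>

lemma capacities_full_conjugate:
  fixes a X :: "'n::finite set cmat"
  assumes aa: "a ** a = complex_of_real (2 * k) \<odot> a" and aXa: "a ** X ** a = 0"
    and X: "X ** X = mat 1" and mu: "cmod \<mu> = 1"
    and tr: "trace a = 1" "trace (X ** a ** X) = 1" and k: "k > 0" and lam: "0 \<le> lam" "lam \<le> 1"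
  defines "b \<equiv> \<mu> \<odot> (a ** X)" and "c \<equiv> cnj \<mu> \<odot> (X ** a)" and "d \<equiv> X ** a ** X"
  shows "vn_entropy (region_state lam a d) - vn_entropy (joint_state lam a b c d) = binary_entropy lam"
    and "entropy_z (joint_state lam a b c d) - vn_entropy (joint_state lam a b c d) = binary_entropy lam"
    and "entropy_phi \<phi> (joint_state lam a b c d) - vn_entropy (joint_state lam a b c d) = 1"
proof -
  have mumu: "\<mu> * cnj \<mu> = 1" "cnj \<mu> * \<mu> = 1"
    using mu complex_norm_square[of \<mu>] by (simp_all add: mult.commute)
  then have mumu': "\<mu> * (cnj \<mu> * x) = x" for x
    by (simp flip: mult.assoc)
  \<comment> \<open>The prefix \<open>z\<close> makes the relations applicable inside longer
    left-associated products.\<close>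
  have z: "z ** a ** a = complex_of_real (2 * k) \<odot> (z ** a)" "z ** a ** X ** a = 0"
    "z ** X ** X = z" for z
    using aa aXa X by (simp_all flip: matrix_mul_assoc)
  have "a ** a = complex_of_real (2 * k) \<odot> a" "a ** b = complex_of_real (2 * k) \<odot> b"
    "a ** c = 0" "a ** d = 0" "b ** a = 0" "b ** b = 0" "b ** c = complex_of_real (2 * k) \<odot> a"
    "b ** d = complex_of_real (2 * k) \<odot> b" "c ** a = complex_of_real (2 * k) \<odot> c"
    "c ** b = complex_of_real (2 * k) \<odot> d" "c ** c = 0" "c ** d = 0" "d ** a = 0" "d ** b = 0"
    "d ** c = complex_of_real (2 * k) \<odot> c" "d ** d = complex_of_real (2 * k) \<odot> d"
    by (simp_all add: b_def c_def d_def matrix_mul_assoc aa aXa X z mumu mumu' mult_ac)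
  note rel = this
  show "vn_entropy (region_state lam a d) - vn_entropy (joint_state lam a b c d) = binary_entropy lam"
    and "entropy_z (joint_state lam a b c d) - vn_entropy (joint_state lam a b c d) = binary_entropy lam"
    and "entropy_phi \<phi> (joint_state lam a b c d) - vn_entropy (joint_state lam a b c d) = 1"
    using capacities_full[OF rel tr(1) _ k lam] tr(2) by (simp_all add: d_def)
qed

lemma outer_mult_vec: "outer u v *v w = (\<Sum>i\<in>UNIV. w $ i * cnj (v $ i)) *s u"
  by (simp add: vec_eq_iff matrix_vector_mult_def sum_distrib_left sum_distrib_right mult_ac)

locale encoded_code = qubit_code S for S :: "'n::finite set cmat set" +
  fixes Xb Zb :: "'n set cmat" and l0 l1 :: "'n set cvec"
  assumes logical_paulis: "logical_paulis S Xb Zb"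
    and logical_basis: "logical_basis S Zb l0 l1"
begin

lemma logical_pauli_facts:
  assumes "P \<in> {Xb, Zb}"
  shows "pauli_on UNIV P" "adj P = P" "P ** P = mat 1" "s \<in> S \<Longrightarrow> P ** s = s ** P"
proof -
  show P: "pauli_on UNIV P" "adj P = P" "s \<in> S \<Longrightarrow> P ** s = s ** P"
    using logical_paulis assms
    by (auto simp: logical_paulis_def carrier_pauli_group hermitian_iff_adj commutes_with_def)
  obtain c f where c: "c \<in> phases" "P = pauli_op c f"
    using P(1) by (auto simp: pauli_on_def)
  have "P ** P = P ** adj P" by (simp add: P)
  also have "\<dots> = mat (c * cnj c)"
    unfolding c(2) adj_pauli_op pauli_op_square by simp
  also have "c * cnj c = 1" using c(1) by (auto simp: phases_def)
  finally show "P ** P = mat 1" by simp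
qed

lemmas X = logical_pauli_facts[of Xb, simplified] and Z = logical_pauli_facts[of Zb, simplified]

lemma ZX: "Zb ** Xb = - (Xb ** Zb)"
  using logical_paulis by (simp add: logical_paulis_def)

definition Yb :: "'n set cmat" where
  "Yb = mat \<i> ** Xb ** Zb"

lemma Yb_eq: "Yb = \<i> \<odot> (Xb ** Zb)"
  unfolding Yb_def mat_eq_cscale[of \<i>] by simp

lemma Y: "pauli_on UNIV Yb" "Yb ** Yb = mat 1" "s \<in> S \<Longrightarrow> Yb ** s = s ** Yb"
proof -
  show "pauli_on UNIV Yb"
    unfolding Yb_eq by (intro pauli_on_cscale pauli_on_mult X Z) (simp add: phases_def)
  have "Xb ** Zb ** (Xb ** Zb) = Xb ** (Zb ** Xb) ** Zb" by (simp only: matrix_mul_assoc)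
  also have "\<dots> = - (Xb ** Xb ** (Zb ** Zb))" by (simp add: ZX matrix_mul_assoc)
  finally show "Yb ** Yb = mat 1" by (simp add: Yb_eq X Z cscale_minus1)
  show "Yb ** s = s ** Yb" if "s \<in> S"
  proof -
    have "Xb ** Zb ** s = Xb ** s ** Zb" by (simp add: Z(4)[OF that] flip: matrix_mul_assoc)
    also have "\<dots> = s ** (Xb ** Zb)" by (simp add: X(4)[OF that] matrix_mul_assoc)
    finally show ?thesis by (simp add: Yb_eq)
  qed
qed

lemma XZ_eq_Y: "Xb ** Zb = - \<i> \<odot> Yb" and ZX_eq_Y: "Zb ** Xb = \<i> \<odot> Yb"
  by (simp_all add: Yb_eq ZX) (simp add: mat_eq_iff)

lemma l0: "l0 \<in> codespace S" "norm l0 = 1" "Zb *v l0 = l0"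
  and l1: "l1 \<in> codespace S" "norm l1 = 1" "Zb *v l1 = - l1"
  using logical_basis by (auto simp: logical_basis_def)

lemma outer_l0_l0: "outer l0 l0 = mixed + mixed ** Zb"
  by (rule outer_eigenvector_eq_mixed[where X = Xb]) (use X Z ZX l0 in auto)

lemma outer_l1_l1: "outer l1 l1 = mixed - mixed ** Zb"
proof -
  have "(- Zb) *v l1 = l1"
    using l1(3) by (simp add: vec_eq_iff matrix_vector_mult_def sum_negf)
  moreover have "adj (- Zb) = - Zb" using Z(2) by (simp add: mat_eq_iff)
  ultimately have "outer l1 l1 = mixed + mixed ** (- Zb)"
    by (intro outer_eigenvector_eq_mixed[where X = Xb]) (use X Z ZX l1 in auto)
  then show ?thesis by simp
qed

lemma ZX_mixed: "Zb ** mixed = mixed ** Zb" "Xb ** mixed = mixed ** Xb"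
  by (intro mixed_commute X Z, assumption)+

text \<open>Expanded in \<open>mixed\<close>, conjugation by \<open>Xb\<close> reverses the sign of
  the \<open>Zb\<close> term and nothing else.\<close>

lemma outer_l1_l1_conjugate: "outer l1 l1 = Xb ** outer l0 l0 ** Xb"
proof -
  have "Xb ** (mixed ** Zb) ** Xb = mixed ** (Xb ** (Zb ** Xb))"
    by (simp add: ZX_mixed(2) matrix_mul_assoc)
  also have "\<dots> = - (mixed ** ((Xb ** Xb) ** Zb))"
    by (simp add: ZX matrix_mul_assoc)
  finally have 1: "Xb ** (mixed ** Zb) ** Xb = - (mixed ** Zb)" by (simp add: X)
  have "Xb ** mixed ** Xb = mixed"
    by (simp add: ZX_mixed(2) X flip: matrix_mul_assoc)
  with 1 show ?thesis
    by (simp add: outer_l0_l0 outer_l1_l1 matrix_add_ldistrib mult_add_left_mat)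
qed

text \<open>\<open>Xb\<close> maps the line of \<open>l0\<close> to the line of \<open>l1\<close>;
  \<mu> is the relative phase that the choice of logical basis leaves free.\<close>

lemma outer_l0_l1:
  obtains \<mu> where "cmod \<mu> = 1" "outer l0 l1 = \<mu> \<odot> (outer l0 l0 ** Xb)"
    "outer l1 l0 = cnj \<mu> \<odot> (Xb ** outer l0 l0)"
proof -
  let ?w = "Xb *v l0"
  \<comment> \<open>The overlap of \<open>l1\<close> with \<open>Xb *v l0\<close>.\<close>
  define \<kappa> where "\<kappa> = (\<Sum>i\<in>UNIV. ?w $ i * cnj (l1 $ i))"
  have ww: "outer ?w ?w = outer l1 l1"
    by (simp add: outer_l1_l1_conjugate outer_mult_left outer_mult_right X)
  have "outer l1 l1 *v ?w = ?w"
  proof -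
    have "outer l1 l1 ** Xb = Xb ** outer l0 l0"
      using X(3) by (simp add: outer_l1_l1_conjugate flip: matrix_mul_assoc)
    then have "outer l1 l1 *v ?w = Xb *v (outer l0 l0 *v l0)"
      by (simp add: matrix_vector_mul_assoc)
    moreover have "outer l0 l0 *v l0 = l0"
      by (simp add: outer_mult_vec norm_vec_square l0)
    ultimately show ?thesis by simp
  qed
  moreover have "outer l1 l1 *v ?w = \<kappa> *s l1"
    by (simp add: \<kappa>_def outer_mult_vec)
  ultimately have w: "?w = \<kappa> *s l1" by simp
  have "trace (outer ?w ?w) = \<kappa> * cnj \<kappa> * trace (outer l1 l1)"
    unfolding w by (simp add: trace_outer sum_distrib_left mult_ac)
  then have kk: "\<kappa> * cnj \<kappa> = 1"
    unfolding ww trace_outer_self l1 by simp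
  then have "(cmod \<kappa>)\<^sup>2 = 1"
    by (metis complex_norm_square of_real_eq_1_iff)
  then have "cmod \<kappa> = 1" using norm_ge_zero[of \<kappa>] unfolding power2_eq_1_iff by linarith
  moreover have l1w: "l1 = cnj \<kappa> *s ?w"
    unfolding w using kk by (simp add: vec_eq_iff mult.commute mult.left_commute flip: mult.assoc)
  have "outer l0 l1 = \<kappa> \<odot> outer l0 ?w" "outer l1 l0 = cnj \<kappa> \<odot> outer ?w l0"
    by (subst l1w, simp add: mat_eq_iff)+
  then have "outer l0 l1 = \<kappa> \<odot> (outer l0 l0 ** Xb)" "outer l1 l0 = cnj \<kappa> \<odot> (Xb ** outer l0 l0)"
    by (simp_all add: outer_mult_left outer_mult_right X)
  ultimately show ?thesis using that by blast
qed

lemma logical_pauli_relations: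
  "Xb ** Yb = - (Yb ** Xb)" "Yb ** Zb = - (Zb ** Yb)"
  "Xb = - \<i> \<odot> (Yb ** Zb)" "Zb = - \<i> \<odot> (Xb ** Yb)"
proof -
  have 1: "Xb ** (Xb ** Zb) = Zb" "Xb ** Zb ** Zb = Xb"
    using X(3) Z(3) by (simp add: matrix_mul_assoc, simp flip: matrix_mul_assoc)
  have "Xb ** Zb ** Xb = - (Xb ** Xb ** Zb)"
    by (simp add: ZX flip: matrix_mul_assoc)
  then have 2: "Xb ** Zb ** Xb = - Zb" by (simp add: X)
  have "Zb ** (Xb ** Zb) = - (Xb ** (Zb ** Zb))"
    by (simp add: matrix_mul_assoc ZX)
  then have 3: "Zb ** (Xb ** Zb) = - Xb" by (simp add: Z)
  show "Xb ** Yb = - (Yb ** Xb)" "Yb ** Zb = - (Zb ** Yb)"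
    "Xb = - \<i> \<odot> (Yb ** Zb)" "Zb = - \<i> \<odot> (Xb ** Yb)"
    by (simp_all add: Yb_eq 1 2 3) (simp_all add: mat_eq_iff)
qed

text \<open>Up to a phase, each of the three operators is the product of the other two. Hence a
  region supports none, exactly one or all of them.\<close>

lemma supports_third:
  "supports R Xb \<Longrightarrow> supports R Yb \<Longrightarrow> supports R Zb"
  "supports R Yb \<Longrightarrow> supports R Zb \<Longrightarrow> supports R Xb"
  "supports R Xb \<Longrightarrow> supports R Zb \<Longrightarrow> supports R Yb"
proof -
  have ph: "- \<i> \<in> phases" "\<i> \<in> phases" by (simp_all add: phases_def)
  show "supports R Xb \<Longrightarrow> supports R Yb \<Longrightarrow> supports R Zb"
    using supports_mult[OF _ _ logical_pauli_relations(4) ph(1)] Y(3) by blast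
  show "supports R Yb \<Longrightarrow> supports R Zb \<Longrightarrow> supports R Xb"
    using supports_mult[OF _ _ logical_pauli_relations(3) ph(1)] Z(4) by blast
  show "supports R Xb \<Longrightarrow> supports R Zb \<Longrightarrow> supports R Yb"
    using supports_mult[OF _ _ Yb_eq ph(2)] Z(4) by blast
qed

lemma supports_disjoint:
  assumes "A \<inter> B = {}"
  shows "supports A Xb \<Longrightarrow> \<not> supports B Yb" "supports A Xb \<Longrightarrow> \<not> supports B Zb"
    "supports A Yb \<Longrightarrow> \<not> supports B Zb"
proof -
  have XZ: "Xb ** Zb = - (Zb ** Xb)" by (simp add: ZX)
  show "supports A Xb \<Longrightarrow> \<not> supports B Yb"
    using anticommuting_not_supported_disjoint[OF _ _ assms logical_pauli_relations(1) X(3) Y(2)] X(4) Y(3) by blast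
  show "supports A Xb \<Longrightarrow> \<not> supports B Zb"
    using anticommuting_not_supported_disjoint[OF _ _ assms XZ X(3) Z(3)] X(4) Z(4) by blast
  show "supports A Yb \<Longrightarrow> \<not> supports B Zb"
    using anticommuting_not_supported_disjoint[OF _ _ assms logical_pauli_relations(2) Y(2) Z(3)] Y(3) Z(4) by blast
qed

lemma logical_ops_supported:
  "(\<exists>L\<in>logical_ops S Xb Zb. supported_on L U \<and> \<not> supported_on L A \<and> \<not> supported_on L B)
    \<longleftrightarrow> (\<exists>P\<in>{Xb, Yb, Zb}. supports U P \<and> \<not> supports A P \<and> \<not> supports B P)"
proof -
  have "supported_on (P <#\<^bsub>pauli_group\<^esub> S) R \<longleftrightarrow> supports R P" for P R
    by (auto simp: supported_on_def supports_def l_coset_def pauli_on_def)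
  then show ?thesis by (simp add: logical_ops_def Yb_def)
qed

definition code_joint_state :: "real \<Rightarrow> 'n set \<Rightarrow> 'n option set cmat" where
  "code_joint_state lam R = joint_state lam (ptrace R (outer l0 l0)) (ptrace R (outer l0 l1))
     (ptrace R (outer l1 l0)) (ptrace R (outer l1 l1))"

definition code_region_state :: "real \<Rightarrow> 'n set \<Rightarrow> 'n option set cmat" where
  "code_region_state lam R = region_state lam (ptrace R (outer l0 l0)) (ptrace R (outer l1 l1))"

lemma ptrace_rho_TAB:
  assumes "R \<subseteq> A \<union> B" and lam: "0 \<le> lam" "lam \<le> 1"
  shows "ptrace (Some ` R) (rho_TAB lam l0 l1 A B) = code_region_state lam R"
    and "ptrace (insert None (Some ` R)) (rho_TAB lam l0 l1 A B) = code_joint_state lam R"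
proof -
  have sub: "Some ` R \<subseteq> insert None (Some ` (A \<union> B))"
    "insert None (Some ` R) \<subseteq> insert None (Some ` (A \<union> B))"
    using assms(1) by auto
  show "ptrace (Some ` R) (rho_TAB lam l0 l1 A B) = code_region_state lam R"
    unfolding rho_TAB_def ptrace_ptrace[OF sub(1)] outer_psi_enc[OF lam] ptrace_Some_blk ptrace_cscale
      code_region_state_def region_state_def ..
  show "ptrace (insert None (Some ` R)) (rho_TAB lam l0 l1 A B) = code_joint_state lam R"
    unfolding rho_TAB_def ptrace_ptrace[OF sub(2)] outer_psi_enc[OF lam] ptrace_insert_None_blk ptrace_cscale
      ptrace_ptrace[OF assms(1)]
      code_joint_state_def joint_state_def ..
qed

text \<open>\<open>c\<close> is the capacity minus 1; \<open>q\<close> is the perpendicular part at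
  one angle or its average, according to what is passed for \<open>gx\<close> and \<open>gy\<close>.
  Supporting \<open>Xb\<close> and \<open>Zb\<close> amounts to supporting all three.\<close>

definition region_values :: "real \<Rightarrow> real \<Rightarrow> real \<Rightarrow> 'n set \<Rightarrow> real \<Rightarrow> real \<Rightarrow> real \<Rightarrow> bool" where
  "region_values h gx gy R c p q \<longleftrightarrow>
     c = (if supports R Xb \<and> supports R Zb then h
          else if supports R Xb \<or> supports R Yb \<or> supports R Zb then 0 else - h) \<and>
     p = (if supports R Xb \<or> supports R Yb then h else 0) \<and>
     q = (if supports R Zb then 1 else if supports R Xb then gx else if supports R Yb then gy else 1 - h)"

text \<open>\<open>gx\<close> and \<open>gy\<close> are chosen before the region: they depend only
  on \<open>lam\<close>, the angle and the phase of the logical basis. This uniformity in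
  \<open>R\<close> lets two regions be compared without evaluating any integral.\<close>

lemma region_capacities:
  assumes lam: "0 \<le> lam" "lam \<le> 1"
  obtains gx gy where "\<And>R \<phi>. region_values (binary_entropy lam) (gx \<phi>) (gy \<phi>) R
    (vn_entropy (code_region_state lam R) - vn_entropy (code_joint_state lam R)) (entropy_z (code_joint_state lam R) - vn_entropy (code_joint_state lam R))
    (entropy_phi \<phi> (code_joint_state lam R) - vn_entropy (code_joint_state lam R))"
proof -
  obtain \<mu> where mu: "cmod \<mu> = 1" and o01: "outer l0 l1 = \<mu> \<odot> (outer l0 l0 ** Xb)"
    and o10: "outer l1 l0 = cnj \<mu> \<odot> (Xb ** outer l0 l0)"
    by (rule outer_l0_l1)
  \<comment> \<open>Used with \<mu> for X and \<i> times \<mu> for Y, because |0_L><1_L| reduces to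
    \<mu> times \<open>fx + \<i> \<odot> fy\<close>.\<close>
  define g where "g \<nu> \<phi> = binary_entropy (1/2 + sqrt (lam * (1 - lam)) * Re (cis \<phi> * \<nu>))" for \<nu> \<phi>
  have "region_values (binary_entropy lam) (g \<mu> \<phi>) (g (\<i> * \<mu>) \<phi>) R
    (vn_entropy (code_region_state lam R) - vn_entropy (code_joint_state lam R)) (entropy_z (code_joint_state lam R) - vn_entropy (code_joint_state lam R))
    (entropy_phi \<phi> (code_joint_state lam R) - vn_entropy (code_joint_state lam R))" for R \<phi>
  proof -
    define f where "f = ptrace R mixed"
    define fx where "fx = ptrace R (mixed ** Xb)"
    define fy where "fy = ptrace R (mixed ** Yb)"
    define fz where "fz = ptrace R (mixed ** Zb)"
    obtain k where k: "k > 0" and ff: "f ** f = complex_of_real k \<odot> f"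
      using ptrace_mixed_square[of R] unfolding f_def by blast
    have trf: "trace f = 1" by (simp add: f_def trace_ptrace trace_mixed)
    have tr: "trace (ptrace R (outer l0 l0)) = 1" "trace (ptrace R (outer l1 l1)) = 1"
      by (simp_all add: trace_ptrace trace_outer_self l0 l1)
    have e00: "ptrace R (outer l0 l0) = f + fz"
      by (simp add: outer_l0_l0 ptrace_add f_def fz_def)
    have "outer l1 l1 = mixed + - 1 \<odot> (mixed ** Zb)"
      by (simp add: outer_l1_l1 cscale_minus1)
    then have e11: "ptrace R (outer l1 l1) = f + - 1 \<odot> fz"
      by (simp only: ptrace_add ptrace_cscale f_def fz_def)
    have "outer l0 l0 ** Xb = mixed ** Xb + mixed ** (Zb ** Xb)"
      by (simp add: outer_l0_l0 mult_add_left_mat matrix_mul_assoc)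
    then have e01: "ptrace R (outer l0 l1) = \<mu> \<odot> (fx + \<i> \<odot> fy)"
      by (simp add: o01 ZX_eq_Y ptrace_add ptrace_cscale fx_def fy_def)
    have "Xb ** outer l0 l0 = mixed ** Xb + mixed ** (Xb ** Zb)"
      by (simp add: outer_l0_l0 matrix_add_ldistrib matrix_mul_assoc ZX_mixed)
    then have e10: "ptrace R (outer l1 l0) = cnj \<mu> \<odot> (fx + - \<i> \<odot> fy)"
      by (simp add: o10 XZ_eq_Y ptrace_add ptrace_cscale fx_def fy_def)
    have x0: "fx = 0" if "\<not> supports R Xb"
      unfolding fx_def by (rule ptrace_mixed_mult_unsupported[OF X(1) X(4) that])
    have y0: "fy = 0" if "\<not> supports R Yb"
      unfolding fy_def by (rule ptrace_mixed_mult_unsupported[OF Y(1) Y(3) that])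
    have z0: "fz = 0" if "\<not> supports R Zb"
      unfolding fz_def by (rule ptrace_mixed_mult_unsupported[OF Z(1) Z(4) that])
    \<comment> \<open>In the applications \<open>K\<close> is a representative on \<open>R\<close>
      of a supported logical operator and \<open>v\<close> its surviving term.\<close>
    have rep: "v ** v = complex_of_real k \<odot> f" "f ** v = complex_of_real k \<odot> v" "v ** f = complex_of_real k \<odot> v"
      if v: "v = f ** K" and K: "K ** K = mat 1" "K ** f = f ** K" for v K
    proof -
      show "v ** v = complex_of_real k \<odot> f"
        unfolding v using mult_swap_middle[OF K(2), of f K] by (simp add: K ff)
      show "f ** v = complex_of_real k \<odot> v"
        unfolding v by (simp add: matrix_mul_assoc ff)
      show "v ** f = complex_of_real k \<odot> v"
      proof -
        have "v ** f = f ** (K ** f)" by (simp only: v matrix_mul_assoc)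
        also have "\<dots> = f ** f ** K" by (simp only: K(2) matrix_mul_assoc)
        finally show ?thesis by (simp add: v ff)
      qed
    qed
    consider (none) "\<not> supports R Xb" "\<not> supports R Yb" "\<not> supports R Zb"
      | (onlyX) "supports R Xb" "\<not> supports R Yb" "\<not> supports R Zb"
      | (onlyY) "\<not> supports R Xb" "supports R Yb" "\<not> supports R Zb"
      | (onlyZ) "\<not> supports R Xb" "\<not> supports R Yb" "supports R Zb"
      | (all) "supports R Xb" "supports R Yb" "supports R Zb"
      using supports_third by blast
    then show ?thesis
    proof cases
      case none
      then have "ptrace R (outer l0 l0) = f" "ptrace R (outer l1 l1) = f" "ptrace R (outer l0 l1) = 0"
        "ptrace R (outer l1 l0) = 0"
        by (simp_all add: e00 e11 e01 e10 x0 y0 z0)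
      then show ?thesis
        using capacities_trivial[OF ff trf k lam] none by (simp add: region_values_def code_region_state_def code_joint_state_def)
    next
      case onlyX
      obtain t where "(Xb ** t) ** (Xb ** t) = mat 1" "fx = f ** (Xb ** t)" "(Xb ** t) ** f = f ** (Xb ** t)"
        unfolding f_def fx_def by (rule supports_rep[OF onlyX(1) X(4) X(3)])
      note v = rep[OF this(2,1,3)]
      have "ptrace R (outer l0 l0) = f" "ptrace R (outer l1 l1) = f" "ptrace R (outer l0 l1) = \<mu> \<odot> fx"
        "ptrace R (outer l1 l0) = cnj \<mu> \<odot> fx"
        using onlyX by (simp_all add: e00 e11 e01 e10 y0 z0)
      then show ?thesis
        using capacities_X[OF ff trf k v mu lam] onlyX by (simp add: region_values_def code_region_state_def code_joint_state_def g_def)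
    next
      case onlyY
      obtain t where "(Yb ** t) ** (Yb ** t) = mat 1" "fy = f ** (Yb ** t)" "(Yb ** t) ** f = f ** (Yb ** t)"
        unfolding f_def fy_def by (rule supports_rep[OF onlyY(2) Y(3) Y(2)])
      note v = rep[OF this(2,1,3)]
      have mu': "cmod (\<i> * \<mu>) = 1" by (simp add: norm_mult mu)
      have "ptrace R (outer l0 l0) = f" "ptrace R (outer l1 l1) = f" "ptrace R (outer l0 l1) = (\<i> * \<mu>) \<odot> fy"
        "ptrace R (outer l1 l0) = cnj (\<i> * \<mu>) \<odot> fy"
        using onlyY by (simp_all add: e00 e11 e01 e10 x0 z0 mult.commute)
      then show ?thesis
        using capacities_X[OF ff trf k v mu' lam] onlyY by (simp add: region_values_def code_region_state_def code_joint_state_def g_def)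
    next
      case onlyZ
      obtain t where t: "(Zb ** t) ** (Zb ** t) = mat 1" "fz = f ** (Zb ** t)" "(Zb ** t) ** f = f ** (Zb ** t)"
        unfolding f_def fz_def by (rule supports_rep[OF onlyZ(3) Z(4) Z(3)])
      note v = rep[OF t(2,1,3)]
      have off: "ptrace R (outer l0 l1) = 0" "ptrace R (outer l1 l0) = 0"
        using onlyZ by (simp_all add: e01 e10 x0 y0)
      \<comment> \<open>\<open>fz\<close> commutes with \<open>f\<close>, and both have square
        \<open>k\<close> times \<open>f\<close>, so \<open>f + fz\<close> and \<open>f - fz\<close>
        annihilate each other.\<close>
      have rel: "(f + fz) ** (f + fz) = complex_of_real (2 * k) \<odot> (f + fz)"
        "(f + - 1 \<odot> fz) ** (f + - 1 \<odot> fz) = complex_of_real (2 * k) \<odot> (f + - 1 \<odot> fz)"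
        "(f + fz) ** (f + - 1 \<odot> fz) = 0" "(f + - 1 \<odot> fz) ** (f + fz) = 0"
        by (simp_all add: matrix_add_ldistrib mult_add_left_mat ff v) (simp_all add: mat_eq_iff algebra_simps)
      show ?thesis
        using capacities_Z[OF rel tr[unfolded e00 e11] k lam] onlyZ
        by (simp add: region_values_def code_region_state_def code_joint_state_def e00 e11 off)
    next
      case all
      obtain t where t: "t \<in> S" "pauli_on R (Xb ** t)" "(Xb ** t) ** (Xb ** t) = mat 1"
        "ptrace R (mixed ** Xb) = ptrace R mixed ** (Xb ** t)"
        "(Xb ** t) ** ptrace R mixed = ptrace R mixed ** (Xb ** t)"
        by (rule supports_rep[OF all(1) X(4) X(3)])
      obtain u where u: "u \<in> S" "pauli_on R (Zb ** u)" "(Zb ** u) ** (Zb ** u) = mat 1"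
        "ptrace R (mixed ** Zb) = ptrace R mixed ** (Zb ** u)"
        "(Zb ** u) ** ptrace R mixed = ptrace R mixed ** (Zb ** u)"
        by (rule supports_rep[OF all(3) Z(4) Z(3)])
      \<comment> \<open>A representative of the logical X inside \<open>R\<close>: it can be moved
        through the partial trace, and on the logical states it acts like \<open>Xb\<close>.\<close>
      define X' where "X' = Xb ** t"
      define a where "a = ptrace R (outer l0 l0)"
      note v = rep[OF u(4)[folded f_def fz_def] u(3) u(5)[folded f_def]]
      have aa: "a ** a = complex_of_real (2 * k) \<odot> a"
        by (simp add: a_def e00 matrix_add_ldistrib mult_add_left_mat ff v) (simp add: mat_eq_iff algebra_simps)
      have ot: "outer l0 l0 ** t = outer l0 l0" "t ** outer l0 l0 = outer l0 l0"
        using l0(1) t(1) S_adj by (simp_all add: outer_mult_left outer_mult_right codespace_def)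
      have X't: "X' = t ** Xb" by (simp add: X'_def X(4)[OF t(1)])
      have OX: "outer l0 l0 ** X' = outer l0 l0 ** Xb"
        by (simp add: X't matrix_mul_assoc ot)
      have XO: "X' ** outer l0 l0 = Xb ** outer l0 l0"
        by (simp add: X'_def ot flip: matrix_mul_assoc)
      have aX: "a ** X' = ptrace R (outer l0 l0 ** Xb)"
        using ptrace_mult_local[OF t(2), of "outer l0 l0"] by (simp add: a_def OX flip: X'_def)
      have Xa: "X' ** a = ptrace R (Xb ** outer l0 l0)"
        using ptrace_local_mult[OF t(2), of "outer l0 l0"] by (simp add: a_def XO flip: X'_def)
      have "X' ** a ** X' = ptrace R (X' ** outer l0 l0 ** X')"
        using ptrace_local_mult[OF t(2), of "outer l0 l0"] ptrace_mult_local[OF t(2), of "Xb ** t ** outer l0 l0"]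
        by (simp add: a_def X'_def)
      also have "X' ** outer l0 l0 ** X' = outer l1 l1"
        by (simp add: XO OX outer_l1_l1_conjugate flip: matrix_mul_assoc)
      finally have XaX: "X' ** a ** X' = ptrace R (outer l1 l1)" .
      have "(f + fz) ** (f + - 1 \<odot> fz) = 0"
        by (simp add: matrix_add_ldistrib mult_add_left_mat ff v) (simp add: mat_eq_iff algebra_simps)
      \<comment> \<open>Since \<open>R\<close> also supports Z, the reductions of |0_L> and |1_L>
        are orthogonal, and the second is the first conjugated by \<open>X'\<close>.\<close>
      then have "a ** (X' ** a ** X') = 0"
        unfolding XaX by (simp add: a_def e00 e11)
      then have "a ** (X' ** a ** X') ** X' = 0" by simp
      then have "a ** X' ** a ** (X' ** X') = 0" by (simp only: matrix_mul_assoc)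
      then have aXa: "a ** X' ** a = 0" by (simp add: X'_def t(3))
      have XX: "X' ** X' = mat 1" by (simp add: X'_def t(3))
      have "code_region_state lam R = region_state lam a (X' ** a ** X')"
        "code_joint_state lam R = joint_state lam a (\<mu> \<odot> (a ** X')) (cnj \<mu> \<odot> (X' ** a)) (X' ** a ** X')"
        by (simp_all only: code_region_state_def code_joint_state_def o01 o10 ptrace_cscale
            a_def[symmetric] aX[symmetric] Xa[symmetric] XaX[symmetric])
      then show ?thesis
        using capacities_full_conjugate[OF aa aXa XX mu tr(1)[folded a_def] tr(2)[folded XaX] k lam] all
        by (simp add: region_values_def)
    qed
  qed
  then show ?thesis using that by blast
qed

end

section \<open>Arithmetic of the synergistic capacity\<close>

text \<open>The term subtracted in C_syn, as a function of two triples. It is fed with capacities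
  lowered by 1: the \<gamma> terms see only differences, so the whole term drops by 1, just as
  \<open>C_AB - 1\<close> does.\<close>

definition pid_sum :: "real \<Rightarrow> real \<Rightarrow> real \<Rightarrow> real \<Rightarrow> real \<Rightarrow> real \<Rightarrow> real" where
  "pid_sum c p q c' p' q' = (let G = max (p - p') 0 + max (q - q') 0; G' = max (p' - p) 0 + max (q' - q) 0 in
     1/2 * (c + c' + \<bar>G + min (c - c' - (G - G')) 0\<bar> + \<bar>G' + min (c' - c - (G' - G)) 0\<bar>))"

lemma pid_sum_commute: "pid_sum c p q c' p' q' = pid_sum c' p' q' c p q"
  by (simp add: pid_sum_def Let_def)

lemma pid_sum_self: "pid_sum c p q c p q = c"
  by (simp add: pid_sum_def)

text \<open>Against a region that supports nothing, the \<gamma> of the other region equals the full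
  capacity difference and the opposite \<gamma> vanishes, so the sum is the larger capacity.\<close>

lemma pid_sum_trivial_right:
  assumes "h > 0"
  shows "pid_sum 0 0 1 (- h) 0 (1 - h) = 0" "pid_sum 0 h g (- h) 0 (1 - h) = 0"
    "pid_sum h h 1 (- h) 0 (1 - h) = h"
proof -
  show "pid_sum 0 0 1 (- h) 0 (1 - h) = 0" "pid_sum h h 1 (- h) 0 (1 - h) = h"
    using assms by (simp_all add: pid_sum_def Let_def)
  \<comment> \<open>The sign of \<open>g - (1 - h)\<close> decides which \<Gamma> collects the
    perpendicular part; the correction by \<Delta> yields the same \<gamma> values either
    way.\<close>
  show "pid_sum 0 h g (- h) 0 (1 - h) = 0"
    using assms by (cases "g \<ge> 1 - h") (simp_all add: pid_sum_def Let_def)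
qed

lemma syn_cap_pid_sum: "syn_cap \<rho> T e0 e1 A B = (cap \<rho> T (A \<union> B) - 1)
    - pid_sum (cap \<rho> T A - 1) (cap_par \<rho> T e0 e1 A) (cap_perp \<rho> T e0 e1 A)
        (cap \<rho> T B - 1) (cap_par \<rho> T e0 e1 B) (cap_perp \<rho> T e0 e1 B)"
  by (simp add: syn_cap_def small_gamma_def big_delta_def big_gamma_def pid_sum_def Let_def field_simps)

text \<open>The shifted capacity has only the levels \<open>- h\<close>, 0 and \<open>h\<close>, for
  no, one and all operators. The subtracted sum is the higher level of the two regions, so a gap
  remains just when the union gains an operator that neither region has.\<close>

lemma synergy_iff:
  assumes h: "h > 0"
    and cA: "cA = (if xA \<and> zA then h else if xA \<or> yA \<or> zA then 0 else - h)"
    and pA: "pA = (if xA \<or> yA then h else 0)"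
    and qA: "qA = (if zA then 1 else if xA then gx else if yA then gy else 1 - h)"
    and cB: "cB = (if xB \<and> zB then h else if xB \<or> yB \<or> zB then 0 else - h)"
    and pB: "pB = (if xB \<or> yB then h else 0)"
    and qB: "qB = (if zB then 1 else if xB then gx else if yB then gy else 1 - h)"
    and cU: "cU = (if xU \<and> zU then h else if xU \<or> yU \<or> zU then 0 else - h)"
    and third: "xA \<and> yA \<longrightarrow> zA" "yA \<and> zA \<longrightarrow> xA" "xA \<and> zA \<longrightarrow> yA"
      "xB \<and> yB \<longrightarrow> zB" "yB \<and> zB \<longrightarrow> xB" "xB \<and> zB \<longrightarrow> yB"
      "xU \<and> yU \<longrightarrow> zU" "yU \<and> zU \<longrightarrow> xU" "xU \<and> zU \<longrightarrow> yU"
    and disjoint: "xA \<longrightarrow> \<not> yB \<and> \<not> zB" "yA \<longrightarrow> \<not> xB \<and> \<not> zB" "zA \<longrightarrow> \<not> xB \<and> \<not> yB"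
    and mono: "xA \<or> xB \<longrightarrow> xU" "yA \<or> yB \<longrightarrow> yU" "zA \<or> zB \<longrightarrow> zU"
  shows "cU - pid_sum cA pA qA cB pB qB \<noteq> 0
    \<longleftrightarrow> xU \<and> \<not> xA \<and> \<not> xB \<or> yU \<and> \<not> yA \<and> \<not> yB \<or> zU \<and> \<not> zA \<and> \<not> zB"
proof -
  have none: "pid_sum 0 0 1 (- h) 0 (1 - h) = 0" "pid_sum 0 h g (- h) 0 (1 - h) = 0"
    "pid_sum h h 1 (- h) 0 (1 - h) = h" "pid_sum (- h) 0 (1 - h) 0 0 1 = 0"
    "pid_sum (- h) 0 (1 - h) 0 h g = 0" "pid_sum (- h) 0 (1 - h) h h 1 = h" for g
    using pid_sum_trivial_right[OF h] pid_sum_commute[of "- h" 0 "1 - h"] by simp_all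
  have sum: "pid_sum cA pA qA cB pB qB
    = (if xA \<and> zA \<or> xB \<and> zB then h else if xA \<or> yA \<or> zA \<or> xB \<or> yB \<or> zB then 0 else - h)"
  proof (cases "xA \<or> yA \<or> zA")
    case False
    then show ?thesis
      using third(4-6) unfolding cA pA qA cB pB qB
      by (cases xB; cases yB; cases zB) (simp_all add: none pid_sum_self)
  next
    case A: True
    show ?thesis
    proof (cases "xB \<or> yB \<or> zB")
      case False
      then show ?thesis
        using third(1-3) A unfolding cA pA qA cB pB qB
        by (cases xA; cases yA; cases zA) (simp_all add: none)
    next
      case True
      \<comment> \<open>Disjointness leaves only one and the same operator for both regions; their
        triples then coincide, whatever \<open>gx\<close> and \<open>gy\<close> are.\<close>
      then have "xA \<and> \<not> yA \<and> \<not> zA \<and> xB \<and> \<not> yB \<and> \<not> zB \<or> \<not> xA \<and> yA \<and> \<not> zA \<and> \<not> xB \<and> yB \<and> \<not> zB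
          \<or> \<not> xA \<and> \<not> yA \<and> zA \<and> \<not> xB \<and> \<not> yB \<and> zB"
        using A disjoint by (cases xA; cases yA; cases zA) simp_all
      then show ?thesis
        unfolding cA pA qA cB pB qB by (elim disjE) (simp_all add: pid_sum_self)
    qed
  qed
  \<comment> \<open>As \<open>h > 0\<close> the levels are distinct, so what remains is
    propositional in the support flags.\<close>
  have level: "(if a then h else if b then 0 else - h) - (if a' then h else if b' then 0 else - h) \<noteq> 0
      \<longleftrightarrow> a \<noteq> a' \<or> \<not> a \<and> b \<noteq> b'" for a b a' b'
    using h by (cases a; cases b; cases a'; cases b') simp_all
  show ?thesis
    unfolding sum cU level using third disjoint mono
    by sat
qed

theorem mainTheorem4:
  fixes S :: "'n::finite set cmat set" and d :: nat
    and Xb Zb :: "'n set cmat" and l0 l1 :: "'n set cvec"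
    and lam :: real and A B :: "'n set"
  assumes "stabilizer_code S d"
    and "logical_paulis S Xb Zb"
    and "logical_basis S Zb l0 l1"
    and "0 < lam" and "lam \<le> 1/2"
    and "A \<inter> B = {}"
  shows "encoded_syn_cap lam l0 l1 A B \<noteq> 0 \<longleftrightarrow>
    (\<exists>L\<in>logical_ops S Xb Zb. supported_on L (A \<union> B) \<and> \<not> supported_on L A \<and> \<not> supported_on L B)"
proof -
  interpret qubit_code S
    using assms(1) by (rule stabilizer_code_imp_qubit_code)
  interpret encoded_code S Xb Zb l0 l1
    by unfold_locales (rule assms(2), rule assms(3))
  \<comment> \<open>Here \<open>0 < lam\<close> enters: it makes the entropy that separates the
    three levels positive.\<close>
  have lam: "0 \<le> lam" "lam \<le> 1" and h: "binary_entropy lam > 0"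
    using assms(4,5) by (auto intro: binary_entropy_pos)
  obtain gx gy where g: "\<And>R \<phi>. region_values (binary_entropy lam) (gx \<phi>) (gy \<phi>) R
    (vn_entropy (code_region_state lam R) - vn_entropy (code_joint_state lam R)) (entropy_z (code_joint_state lam R) - vn_entropy (code_joint_state lam R))
    (entropy_phi \<phi> (code_joint_state lam R) - vn_entropy (code_joint_state lam R))"
    using region_capacities[OF lam] by blast
  let ?\<rho> = "rho_TAB lam l0 l1 A B" and ?avg = "\<lambda>F. 1 / (2 * pi) * integral {0..2 * pi} F"
  define Gx where "Gx = ?avg gx"
  define Gy where "Gy = ?avg gy"
  have avg_const: "?avg (\<lambda>_. c) = c" for c :: real
    by simp
  have vals: "region_values (binary_entropy lam) Gx Gy R (cap ?\<rho> None (Some ` R) - 1)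
      (cap_par ?\<rho> None (ket False) (ket True) (Some ` R))
      (cap_perp ?\<rho> None (ket False) (ket True) (Some ` R))"
    if R: "R \<subseteq> A \<union> B" for R
  proof -
    note pt = ptrace_rho_TAB[OF R lam]
    have c: "cap ?\<rho> None (Some ` R) - 1 = vn_entropy (code_region_state lam R) - vn_entropy (code_joint_state lam R)"
      by (simp add: cap_def pt)
    have p: "cap_par ?\<rho> None (ket False) (ket True) (Some ` R) = entropy_z (code_joint_state lam R) - vn_entropy (code_joint_state lam R)"
      by (simp add: cap_par_def cap_sigma_def pt entropy_z_def)
    have q: "cap_perp ?\<rho> None (ket False) (ket True) (Some ` R)
      = ?avg (\<lambda>\<phi>. entropy_phi \<phi> (code_joint_state lam R) - vn_entropy (code_joint_state lam R))"
      by (simp add: cap_perp_def cap_sigma_def pt entropy_phi_def)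
    \<comment> \<open>The integrands agree as functions of the angle, so their averages agree
      without any question of integrability.\<close>
    have "(\<lambda>\<phi>. entropy_phi \<phi> (code_joint_state lam R) - vn_entropy (code_joint_state lam R))
      = (if supports R Zb then (\<lambda>_. 1) else if supports R Xb then gx else if supports R Yb then gy
         else (\<lambda>_. 1 - binary_entropy lam))"
      using g[of _ R] by (auto simp: region_values_def)
    then have "cap_perp ?\<rho> None (ket False) (ket True) (Some ` R)
      = (if supports R Zb then 1 else if supports R Xb then Gx else if supports R Yb then Gy else 1 - binary_entropy lam)"
      unfolding q by (simp only: Gx_def Gy_def avg_const if_distrib[of ?avg] split: if_split)
    \<comment> \<open>\<open>undefined\<close> serves as the angle, on which the first two
      components do not depend.\<close>
    then show ?thesis
      using g[of undefined R] by (simp add: region_values_def c p)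
  qed
  have A: "A \<subseteq> A \<union> B" and B: "B \<subseteq> A \<union> B" by auto
  note vA = vals[OF A, unfolded region_values_def] and vB = vals[OF B, unfolded region_values_def]
    and vAB = vals[OF subset_refl, unfolded region_values_def]
  have mono: "supports A P \<Longrightarrow> supports (A \<union> B) P" "supports B P \<Longrightarrow> supports (A \<union> B) P" for P
    using supports_mono by blast+
  have BA: "B \<inter> A = {}" using assms(6) by blast
  have syn: "encoded_syn_cap lam l0 l1 A B = (cap ?\<rho> None (Some ` (A \<union> B)) - 1)
    - pid_sum (cap ?\<rho> None (Some ` A) - 1) (cap_par ?\<rho> None (ket False) (ket True) (Some ` A))
        (cap_perp ?\<rho> None (ket False) (ket True) (Some ` A))
        (cap ?\<rho> None (Some ` B) - 1) (cap_par ?\<rho> None (ket False) (ket True) (Some ` B))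
        (cap_perp ?\<rho> None (ket False) (ket True) (Some ` B))"
    by (simp add: encoded_syn_cap_def syn_cap_pid_sum image_Un)
  note conj = conjunct1 conjunct2[THEN conjunct1] conjunct2[THEN conjunct2]
  have "encoded_syn_cap lam l0 l1 A B \<noteq> 0 \<longleftrightarrow>
      supports (A \<union> B) Xb \<and> \<not> supports A Xb \<and> \<not> supports B Xb \<or>
      supports (A \<union> B) Yb \<and> \<not> supports A Yb \<and> \<not> supports B Yb \<or>
      supports (A \<union> B) Zb \<and> \<not> supports A Zb \<and> \<not> supports B Zb"
    unfolding syn
    by (rule synergy_iff[OF h conj[OF vA] conj[OF vB] conj(1)[OF vAB]])
      (use supports_third supports_disjoint[OF assms(6)] supports_disjoint[OF BA] mono in blast)+
  then show ?thesis
    unfolding logical_ops_supported by simp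
qed

end
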